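(* The universal theory of $\mathbf{Q}_\Pi$ is axiomatized relative to $\mathsf{RPA}$ by the sentences \[\forall x y\,(x\le y\ \text{or}\ y\le x),\qquad \mathbf{c}_q\not\approx 1,\qquad \forall x\,(\mathbf{c}_p\not\approx x^n),\] for each (equivalently, some) $q\in(0,1)\cap\mathbb{Q}$ and each $p\in[0,1)\cap\mathbb{Q}$ and $n\in\omega$ such that $\sqrt[n]{p}$ is irrational.
   Context: A BL-algebra is an algebra $\langle A;\wedge,\vee,\cdot,\to,0,1\rangle$ such that $\langle A;\wedge,\vee,0,1\rangle$ is a bounded lattice, $\langle A;\cdot,1\rangle$ is a commutative monoid, $a\cdot b\le c\iff a\le b\to c$, $(a\to c)\vee(c\to a)=1$ and $a\wedge c=a\cdot(a\to c)$. The standard product algebra $[0,1]_\Pi$ is the BL-algebra on $[0,1]$ with usual order, real multiplication and $a\to c=1$ if $a\le c$, $c/a$ otherwise; product algebras are the members of the variety it generates. With new constants $\{\mathbf{c}_q:q\in[0,1]\cap\mathbb{Q}\}$, a rational product algebra is an algebra in the BL language expanded by these constants whose BL-reduct is a product algebra and satisfying $\mathbf{c}_p\cdot\mathbf{c}_q\approx\mathbf{c}_{pq}$, $\mathbf{c}_p\to\mathbf{c}_q\approx\mathbf{c}_{p\to q}$ (computed in $[0,1]_\Pi$), $\mathbf{c}_0\approx0$, $\mathbf{c}_1\approx1$; $\mathsf{RPA}$ is their variety. $\mathbf{Q}_\Pi$ is the subalgebra of $[0,1]_\Pi$ on $[0,1]\cap\mathbb{Q}$ with $\mathbf{c}_q$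 interpreted as $q$. $x^n$ denotes the $n$-fold product $x\cdot\dots\cdot x$, and $x\le y$ abbreviates $x\wedge y\approx x$. *)

theory Defs
  imports Complex_Main
begin

record 'a bl_struct =
  carrier :: "'a set"
  meet :: "'a \<Rightarrow> 'a \<Rightarrow> 'a"
  join :: "'a \<Rightarrow> 'a \<Rightarrow> 'a"
  mult :: "'a \<Rightarrow> 'a \<Rightarrow> 'a"
  resid :: "'a \<Rightarrow> 'a \<Rightarrow> 'a"
  bot_el :: 'a
  top_el :: 'a

definition bl_structure :: "('a, 'm) bl_struct_scheme \<Rightarrow> bool" where
  "bl_structure A \<longleftrightarrow>
     bot_el A \<in> carrier A \<and> top_el A \<in> carrier A \<and>
     (\<forall>a\<in>carrier A. \<forall>b\<in>carrier A.
        meet A a b \<in> carrier A \<and> join A a b \<in> carrier A \<and>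
        mult A a b \<in> carrier A \<and> resid A a b \<in> carrier A)"

definition bl_le :: "('a, 'm) bl_struct_scheme \<Rightarrow> 'a \<Rightarrow> 'a \<Rightarrow> bool" where
  "bl_le A a b \<longleftrightarrow> meet A a b = a"

definition bl_bounded_lattice :: "('a, 'm) bl_struct_scheme \<Rightarrow> bool" where
  "bl_bounded_lattice A \<longleftrightarrow>
     (\<forall>a\<in>carrier A. \<forall>b\<in>carrier A.
        meet A a b = meet A b a \<and> join A a b = join A b a \<and>
        meet A a (join A a b) = a \<and> join A a (meet A a b) = a) \<and>
     (\<forall>a\<in>carrier A. \<forall>b\<in>carrier A. \<forall>c\<in>carrier A.
        meet A (meet A a b) c = meet A a (meet A b c) \<and>
        join A (join A a b) c = join A a (join A b c)) \<and>
     (\<forall>a\<in>carrier A. bl_le A (bot_el A) a \<and> bl_le A a (top_el A))"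

definition bl_comm_monoid :: "('a, 'm) bl_struct_scheme \<Rightarrow> bool" where
  "bl_comm_monoid A \<longleftrightarrow>
     (\<forall>a\<in>carrier A. \<forall>b\<in>carrier A. \<forall>c\<in>carrier A.
        mult A (mult A a b) c = mult A a (mult A b c)) \<and>
     (\<forall>a\<in>carrier A. \<forall>b\<in>carrier A. mult A a b = mult A b a) \<and>
     (\<forall>a\<in>carrier A. mult A a (top_el A) = a)"

definition bl_algebra :: "('a, 'm) bl_struct_scheme \<Rightarrow> bool" where
  "bl_algebra A \<longleftrightarrow>
     bl_structure A \<and> bl_bounded_lattice A \<and> bl_comm_monoid A \<and>
     (\<forall>a\<in>carrier A. \<forall>b\<in>carrier A. \<forall>c\<in>carrier A.
        bl_le A (mult A a b) c \<longleftrightarrow> bl_le A a (resid A b c)) \<and>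
     (\<forall>a\<in>carrier A. \<forall>c\<in>carrier A. join A (resid A a c) (resid A c a) = top_el A) \<and>
     (\<forall>a\<in>carrier A. \<forall>c\<in>carrier A. meet A a c = mult A a (resid A a c))"

datatype bl_term =
    BVar nat
  | BMeet bl_term bl_term
  | BJoin bl_term bl_term
  | BMult bl_term bl_term
  | BResid bl_term bl_term
  | BZero
  | BOne

primrec bl_eval :: "('a, 'm) bl_struct_scheme \<Rightarrow> (nat \<Rightarrow> 'a) \<Rightarrow> bl_term \<Rightarrow> 'a" where
  "bl_eval A v (BVar i) = v i"
| "bl_eval A v (BMeet s t) = meet A (bl_eval A v s) (bl_eval A v t)"
| "bl_eval A v (BJoin s t) = join A (bl_eval A v s) (bl_eval A v t)"
| "bl_eval A v (BMult s t) = mult A (bl_eval A v s) (bl_eval A v t)"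
| "bl_eval A v (BResid s t) = resid A (bl_eval A v s) (bl_eval A v t)"
| "bl_eval A v BZero = bot_el A"
| "bl_eval A v BOne = top_el A"

definition bl_identity_holds :: "('a, 'm) bl_struct_scheme \<Rightarrow> bl_term \<Rightarrow> bl_term \<Rightarrow> bool" where
  "bl_identity_holds A s t \<longleftrightarrow>
     (\<forall>v. (\<forall>i. v i \<in> carrier A) \<longrightarrow> bl_eval A v s = bl_eval A v t)"

definition prod_imp :: "'a::linordered_field \<Rightarrow> 'a \<Rightarrow> 'a" where
  "prod_imp a c = (if a \<le> c then 1 else c / a)"

definition std_product_algebra :: "real bl_struct" where
  "std_product_algebra =
     \<lparr> carrier = {0..1}, meet = min, join = max, mult = (*), resid = prod_imp,
       bot_el = 0, top_el = 1 \<rparr>"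

text \<open>The variety generated by an algebra is the least equational class containing it, that is,
  the class of all algebras of the same type satisfying every identity of that algebra.
  The record scheme type lets \<^term>\<open>product_algebra\<close> apply directly to BL-reducts of structures
  with further operations.\<close>

definition product_algebra :: "('a, 'm) bl_struct_scheme \<Rightarrow> bool" where
  "product_algebra A \<longleftrightarrow>
     bl_algebra A \<and>
     (\<forall>s t. bl_identity_holds std_product_algebra s t \<longrightarrow> bl_identity_holds A s t)"

typedef unit_rat = "{q :: rat. 0 \<le> q \<and> q \<le> 1}"
  morphisms rat_of_unit Abs_unit_rat
  by (rule exI[of _ 0]) simp

setup_lifting type_definition_unit_rat

lift_definition ur_zero :: unit_rat is 0 by simp

lift_definition ur_one :: unit_rat is 1 by simp

lift_definition ur_mult :: "unit_rat \<Rightarrow> unit_rat \<Rightarrow> unit_rat" is "(*)"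
  by (simp add: mult_le_one)

lift_definition ur_imp :: "unit_rat \<Rightarrow> unit_rat \<Rightarrow> unit_rat" is prod_imp
  by (auto simp: prod_imp_def divide_simps)

record 'a rpa_struct = "'a bl_struct" +
  cst :: "unit_rat \<Rightarrow> 'a"

definition rpa_structure :: "'a rpa_struct \<Rightarrow> bool" where
  "rpa_structure A \<longleftrightarrow> bl_structure A \<and> (\<forall>q. cst A q \<in> carrier A)"

definition RPA :: "'a rpa_struct set" where
  "RPA = {A. rpa_structure A \<and> product_algebra A \<and>
     (\<forall>p q. mult A (cst A p) (cst A q) = cst A (ur_mult p q)) \<and>
     (\<forall>p q. resid A (cst A p) (cst A q) = cst A (ur_imp p q)) \<and>
     cst A ur_zero = bot_el A \<and> cst A ur_one = top_el A}"

definition Q_Pi :: "real rpa_struct" where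
  "Q_Pi =
     \<lparr> carrier = {0..1} \<inter> \<rat>, meet = min, join = max, mult = (*), resid = prod_imp,
       bot_el = 0, top_el = 1, cst = (\<lambda>q. of_rat (rat_of_unit q)) \<rparr>"

datatype rpa_term =
    Var nat
  | Meet rpa_term rpa_term
  | Join rpa_term rpa_term
  | Mult rpa_term rpa_term
  | Resid rpa_term rpa_term
  | Zero
  | One
  | Cst unit_rat

primrec eval_term :: "'a rpa_struct \<Rightarrow> (nat \<Rightarrow> 'a) \<Rightarrow> rpa_term \<Rightarrow> 'a" where
  "eval_term A v (Var i) = v i"
| "eval_term A v (Meet s t) = meet A (eval_term A v s) (eval_term A v t)"
| "eval_term A v (Join s t) = join A (eval_term A v s) (eval_term A v t)"
| "eval_term A v (Mult s t) = mult A (eval_term A v s) (eval_term A v t)"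
| "eval_term A v (Resid s t) = resid A (eval_term A v s) (eval_term A v t)"
| "eval_term A v Zero = bot_el A"
| "eval_term A v One = top_el A"
| "eval_term A v (Cst q) = cst A q"

primrec term_vars :: "rpa_term \<Rightarrow> nat set" where
  "term_vars (Var i) = {i}"
| "term_vars (Meet s t) = term_vars s \<union> term_vars t"
| "term_vars (Join s t) = term_vars s \<union> term_vars t"
| "term_vars (Mult s t) = term_vars s \<union> term_vars t"
| "term_vars (Resid s t) = term_vars s \<union> term_vars t"
| "term_vars Zero = {}"
| "term_vars One = {}"
| "term_vars (Cst q) = {}"

datatype fmla =
    Eq rpa_term rpa_term
  | Neg fmla
  | Conj fmla fmla
  | Disj fmla fmla
  | Forall nat fmla

primrec sat :: "'a rpa_struct \<Rightarrow> (nat \<Rightarrow> 'a) \<Rightarrow> fmla \<Rightarrow> bool" where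
  "sat A v (Eq s t) \<longleftrightarrow> eval_term A v s = eval_term A v t"
| "sat A v (Neg \<phi>) \<longleftrightarrow> \<not> sat A v \<phi>"
| "sat A v (Conj \<phi> \<psi>) \<longleftrightarrow> sat A v \<phi> \<and> sat A v \<psi>"
| "sat A v (Disj \<phi> \<psi>) \<longleftrightarrow> sat A v \<phi> \<or> sat A v \<psi>"
| "sat A v (Forall i \<phi>) \<longleftrightarrow> (\<forall>a\<in>carrier A. sat A (v(i := a)) \<phi>)"

primrec free_vars :: "fmla \<Rightarrow> nat set" where
  "free_vars (Eq s t) = term_vars s \<union> term_vars t"
| "free_vars (Neg \<phi>) = free_vars \<phi>"
| "free_vars (Conj \<phi> \<psi>) = free_vars \<phi> \<union> free_vars \<psi>"
| "free_vars (Disj \<phi> \<psi>) = free_vars \<phi> \<union> free_vars \<psi>"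
| "free_vars (Forall i \<phi>) = free_vars \<phi> - {i}"

primrec quantifier_free :: "fmla \<Rightarrow> bool" where
  "quantifier_free (Eq s t) \<longleftrightarrow> True"
| "quantifier_free (Neg \<phi>) \<longleftrightarrow> quantifier_free \<phi>"
| "quantifier_free (Conj \<phi> \<psi>) \<longleftrightarrow> quantifier_free \<phi> \<and> quantifier_free \<psi>"
| "quantifier_free (Disj \<phi> \<psi>) \<longleftrightarrow> quantifier_free \<phi> \<and> quantifier_free \<psi>"
| "quantifier_free (Forall i \<phi>) \<longleftrightarrow> False"

inductive universal_fmla :: "fmla \<Rightarrow> bool" where
  "quantifier_free \<phi> \<Longrightarrow> universal_fmla \<phi>"
| "universal_fmla \<phi> \<Longrightarrow> universal_fmla (Forall i \<phi>)"

definition universal_sentence :: "fmla \<Rightarrow> bool" where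
  "universal_sentence \<phi> \<longleftrightarrow> universal_fmla \<phi> \<and> free_vars \<phi> = {}"

definition holds_in :: "'a rpa_struct \<Rightarrow> fmla \<Rightarrow> bool" where
  "holds_in A \<phi> \<longleftrightarrow> (\<forall>v. (\<forall>i. v i \<in> carrier A) \<longrightarrow> sat A v \<phi>)"

definition universal_theory :: "'a rpa_struct \<Rightarrow> fmla set" where
  "universal_theory A = {\<phi>. universal_sentence \<phi> \<and> holds_in A \<phi>}"

definition Mod :: "fmla set \<Rightarrow> 'a rpa_struct set" where
  "Mod T = {A. rpa_structure A \<and> (\<forall>\<phi>\<in>T. holds_in A \<phi>)}"

definition le_fmla :: "rpa_term \<Rightarrow> rpa_term \<Rightarrow> fmla" where
  "le_fmla s t = Eq (Meet s t) s"

primrec pow_term :: "rpa_term \<Rightarrow> nat \<Rightarrow> rpa_term" where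
  "pow_term t 0 = One"
| "pow_term t (Suc n) = Mult t (pow_term t n)"

definition open_unit_rats :: "unit_rat set" where
  "open_unit_rats = {q. 0 < rat_of_unit q \<and> rat_of_unit q < 1}"

definition linearity_axiom :: fmla where
  "linearity_axiom =
     Forall 0 (Forall 1 (Disj (le_fmla (Var 0) (Var 1)) (le_fmla (Var 1) (Var 0))))"

definition nontriviality_axiom :: "unit_rat \<Rightarrow> fmla" where
  "nontriviality_axiom q = Neg (Eq (Cst q) One)"

definition no_root_axiom :: "unit_rat \<Rightarrow> nat \<Rightarrow> fmla" where
  "no_root_axiom p n = Forall 0 (Neg (Eq (Cst p) (pow_term (Var 0) n)))"

text \<open>The set \<open>S\<close> collects the rationals \<open>q\<close> for which \<open>c_q \<noteq> 1\<close> is an axiom.\<close>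

definition QPi_axioms :: "unit_rat set \<Rightarrow> fmla set" where
  "QPi_axioms S =
     {linearity_axiom} \<union> nontriviality_axiom ` S \<union>
     {no_root_axiom p n | p n.
        rat_of_unit p < 1 \<and> n \<ge> 1 \<and> root n (of_rat (rat_of_unit p)) \<notin> \<rat>}"

end

theory Submission imports Defs begin

text \<open>Let \<open>A\<close> be a chain in \<open>RPA\<close> satisfying the axioms. Its nonzero elements form a cancellative monoid,
  so that the monomials in finitely many of them, with coefficients \<open>c\<^sub>q\<close>, generate an ordered
  abelian group \<open>H\<close> containing the positive rationals; the axioms on roots say that the rationals are
  pure in \<open>H\<close>. A quantifier-free formula at given elements of \<open>A\<close> depends only on the comparison of
  finitely many monomials with \<open>1\<close>. Written with logarithms, these comparisons are linear
  constraints over \<open>log_rats\<close>. Equalities are eliminated by unimodular changes of generators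
  (Euclid's algorithm), which by purity end with a generator that is itself rational; the remaining
  strict inequalities are solved by Fourier--Motzkin elimination and the density of the rationals.
  So the formula takes the same truth value at some rational point of \<open>[0,1]\<close>.\<close>

section \<open>Cones over a dense group of reals\<close>

text \<open>The obstacle is that the positive rationals are dense but not divisible. Strict
  inequalities solvable over the reals are solvable in \<open>log_rats\<close>, whereas an equation
  n * x = l is solvable there only if l / n is again the logarithm of a rational. So relations
  cannot be solved by dividing; they are reduced to a relation in one generator, where purity
  permits the division. The root axioms are not literally purity: they speak of elements of
  \<open>A\<close>, while \<open>H\<close> also has elements above 1.
  \<open>root_of_quotient\<close> closes this gap. The group \<open>H\<close> is never constructed.
  \<open>pure_cone\<close> axiomatizes only which formal monomials are at most 1, and in
  \<open>A\<close> this is decided by comparing a numerator with a denominator. The bottom element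
  has no place in a group, so the set of variables with value bottom is recorded first and copied to
  the rational point. One nontrivial constant suffices because the powers of any r < 1 become
  smaller than every positive rational.\<close>

locale dense_subgroup =
  fixes L :: "real set"
  assumes zero: "0 \<in> L"
    and add: "\<lbrakk>x \<in> L; y \<in> L\<rbrakk> \<Longrightarrow> x + y \<in> L"
    and minus: "x \<in> L \<Longrightarrow> - x \<in> L"
    and dense: "x < y \<Longrightarrow> \<exists>z\<in>L. x < z \<and> z < y"
begin

lemma diff: "\<lbrakk>x \<in> L; y \<in> L\<rbrakk> \<Longrightarrow> x - y \<in> L"
  using add[of x "- y"] minus[of y] by simp

lemma nat_mult: "x \<in> L \<Longrightarrow> of_nat n * x \<in> L"
  by (induction n) (auto simp: zero add algebra_simps)

lemma int_mult: "x \<in> L \<Longrightarrow> of_int k * x \<in> L"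
  by (cases k) (use nat_mult[of x] minus[of "of_nat _ * x"] in \<open>auto simp del: of_nat_Suc\<close>)

lemma between_finite:
  assumes "finite A" "finite B" and lt: "\<And>a b. \<lbrakk>a \<in> A; b \<in> B\<rbrakk> \<Longrightarrow> a < b"
  shows "\<exists>z\<in>L. (\<forall>a\<in>A. a < z) \<and> (\<forall>b\<in>B. z < b)"
proof -
  \<comment> \<open>If \<open>A\<close> or \<open>B\<close> is empty, the missing bound is put at
    distance 1 from the other one, or from 0 if both are empty. So \<open>lo < hi\<close> in all
    cases and density is applied once.\<close>
  define lo where "lo = (if A = {} then (if B = {} then 0 else Min B - 1) else Max A)"
  define hi where "hi = (if B = {} then lo + 1 else Min B)"
  have "lo < hi"
    using assms(1,2) lt[OF Max_in Min_in] by (auto simp: lo_def hi_def simp del: Min_gr_iff)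
  then obtain z where z: "z \<in> L" "lo < z" "z < hi"
    using dense by blast
  have "a < z" if "a \<in> A" for a
  proof -
    have "a \<le> Max A" using that assms(1) by simp
    then show ?thesis using z(2) that by (auto simp: lo_def split: if_splits)
  qed
  moreover have "z < b" if "b \<in> B" for b
  proof -
    have "Min B \<le> b" using that assms(2) by simp
    then show ?thesis using z(3) that by (auto simp: hi_def split: if_splits)
  qed
  ultimately show ?thesis using z(1) by blast
qed

end

text \<open>\<open>P l a\<close> stands for \<open>l + (\<Sum>i. a i * x i) \<le> 0\<close>, where the \<open>x i\<close> are elements of
  some ordered abelian group extension of \<open>L\<close> in which \<open>L\<close> is a pure subgroup.\<close>

locale pure_cone = dense_subgroup L for L :: "real set" +
  fixes P :: "real \<Rightarrow> ('i \<Rightarrow> int) \<Rightarrow> bool"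
  assumes P_add: "\<lbrakk>P l a; P m b\<rbrakk> \<Longrightarrow> P (l + m) (\<lambda>i. a i + b i)"
    and P_total: "l \<in> L \<Longrightarrow> P l a \<or> P (- l) (\<lambda>i. - a i)"
    and P_const: "l \<in> L \<Longrightarrow> P l (\<lambda>i. 0) \<longleftrightarrow> l \<le> 0"
    and P_pure: "\<lbrakk>l \<in> L; n > 0; P l (\<lambda>i. int n * a i); P (- l) (\<lambda>i. - (int n * a i))\<rbrakk>
      \<Longrightarrow> l / real n \<in> L"
begin

text \<open>With \<open>P l a\<close> read as a form being at most 0, \<open>S l a\<close> says that
  the form is negative and \<open>E l a\<close> that it vanishes.\<close>

abbreviation "S l a \<equiv> \<not> P (- l) (\<lambda>i. - a i)"

abbreviation "E l a \<equiv> P l a \<and> P (- l) (\<lambda>i. - a i)"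

lemma P_nat_mult: "P l a \<Longrightarrow> P (of_nat n * l) (\<lambda>i. int n * a i)"
proof (induction n)
  case 0
  then show ?case using P_const[OF zero] by simp
next
  case (Suc n)
  from P_add[OF Suc.IH[OF Suc.prems] Suc.prems] show ?case
    by (simp add: algebra_simps)
qed

lemma S_add:
  assumes "l \<in> L" "m \<in> L" "S l a" "S m b"
  shows "S (l + m) (\<lambda>i. a i + b i)"
proof
  assume "P (- (l + m)) (\<lambda>i. - (a i + b i))"
  moreover have "P l a" using P_total assms(1,3) by blast
  ultimately have "P (- (l + m) + l) (\<lambda>i. - (a i + b i) + a i)"
    by (rule P_add)
  with assms(4) show False by simp
qed

lemma S_nat_mult:
  assumes "l \<in> L" "S l a"
  shows "S (of_nat (Suc n) * l) (\<lambda>i. int (Suc n) * a i)"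
proof (induction n)
  case 0
  then show ?case using assms by simp
next
  case (Suc n)
  from S_add[OF nat_mult[OF assms(1), of "Suc n"] assms(1) Suc assms(2)]
  show ?case by (simp add: algebra_simps)
qed

lemma S_int_mult:
  assumes "l \<in> L" "S l a" "k > 0"
  shows "S (of_int k * l) (\<lambda>i. k * a i)"
proof -
  obtain n where "k = int (Suc n)"
    using assms(3) by (metis gr0_conv_Suc zero_less_imp_eq_int)
  with S_nat_mult[OF assms(1,2), of n] show ?thesis by simp
qed

lemma S_const: "\<lbrakk>l \<in> L; S l (\<lambda>i. 0)\<rbrakk> \<Longrightarrow> l < 0"
  using P_const[of "- l"] minus[of l] by auto

text \<open>Fourier--Motzkin elimination.\<close>

lemma strict_solution:
  assumes "finite I" "finite F"
    and "\<And>l a. (l, a) \<in> F \<Longrightarrow> l \<in> L \<and> (\<forall>i. i \<notin> I \<longrightarrow> a i = 0) \<and> S l a"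
  shows "\<exists>y. (\<forall>i. y i \<in> L) \<and> (\<forall>(l, a)\<in>F. l + (\<Sum>i\<in>I. of_int (a i) * y i) < 0)"
  using assms
proof (induction I arbitrary: F rule: finite_induct)
  case empty
  have "l < 0" if "(l, a) \<in> F" for l a
  proof -
    have "a = (\<lambda>i. 0)" using empty(2)[OF that] by auto
    then show ?thesis using empty(2)[OF that] S_const by blast
  qed
  then show ?case using zero by (intro exI[of _ "\<lambda>_. 0"]) auto
next
  case (insert k I)
  define Up where "Up = {x \<in> F. snd x k > 0}"
  define Lo where "Lo = {x \<in> F. snd x k < 0}"
  \<comment> \<open>The combination of an upper and a lower constraint in which the coefficient of
    \<open>k\<close> cancels. Both multipliers, \<open>- b k\<close> and \<open>a k\<close>, are
    positive, so strictness survives.\<close>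
  define comb where "comb = (\<lambda>((l :: real, a), (m :: real, b)).
    (of_int (- b k) * l + of_int (a k) * m, \<lambda>i. - b k * a i + a k * (b i :: int)))"
  define F' where "F' = {x \<in> F. snd x k = 0} \<union> comb ` (Up \<times> Lo)"
  have fin: "finite Up" "finite Lo" "finite F'"
    using insert.prems(1) by (auto simp: Up_def Lo_def F'_def)
  have F': "l \<in> L \<and> (\<forall>i. i \<notin> I \<longrightarrow> a i = 0) \<and> S l a" if mem: "(l, a) \<in> F'" for l a
  proof -
    consider (old) "(l, a) \<in> F" "a k = 0"
      | (new) l1 a1 l2 a2 where "(l1, a1) \<in> F" "a1 k > 0" "(l2, a2) \<in> F" "a2 k < 0"
        "l = of_int (- a2 k) * l1 + of_int (a1 k) * l2" "a = (\<lambda>i. - a2 k * a1 i + a1 k * a2 i)"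
      using mem by (fastforce simp: F'_def Up_def Lo_def comb_def)
    then show ?thesis
    proof cases
      case old
      then show ?thesis using insert.prems(2)[of l a] by (metis insertE)
    next
      case new
      note p1 = insert.prems(2)[OF new(1)] and p2 = insert.prems(2)[OF new(3)]
      have "a i = 0" if "i \<notin> I" for i
        using p1 p2 that unfolding new(6) by (cases "i = k") auto
      moreover have "S l a"
        unfolding new(5,6) using p1 p2 new(2,4)
        by (intro S_add S_int_mult int_mult) auto
      moreover have "l \<in> L"
        unfolding new(5) using p1 p2 by (intro add int_mult) auto
      ultimately show ?thesis by blast
    qed
  qed
  obtain y where y: "\<And>i. y i \<in> L"
    and sol: "\<And>l a. (l, a) \<in> F' \<Longrightarrow> l + (\<Sum>i\<in>I. of_int (a i) * y i) < 0"
    using insert.IH[OF fin(3) F'] by blast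
  define f where "f = (\<lambda>(l, a). l + (\<Sum>i\<in>I. of_int (a i :: int) * y i))"
  \<comment> \<open>The value of variable \<open>k\<close> at which the constraint becomes an
    equality once the other variables are set to \<open>y\<close>: an upper bound for constraints in
    \<open>Up\<close>, a lower bound for those in \<open>Lo\<close>.\<close>
  define bd where "bd = (\<lambda>x. - f x / of_int (snd x k))"
  have bounds: "s < t" if "s \<in> bd ` Lo" "t \<in> bd ` Up" for s t
  proof -
    from that obtain l a m b where
      u: "(l, a) \<in> Up" "t = bd (l, a)" and w: "(m, b) \<in> Lo" "s = bd (m, b)"
      by auto
    have pos: "a k > 0" "b k < 0" using u w by (auto simp: Up_def Lo_def)
    have "comb ((l, a), (m, b)) \<in> F'" using u w by (auto simp: F'_def)
    then have "of_int (- b k) * l + of_int (a k) * m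
        + (\<Sum>i\<in>I. of_int (- b k * a i + a k * b i) * y i) < 0"
      by (intro sol) (simp add: comb_def)
    also have "(\<Sum>i\<in>I. of_int (- b k * a i + a k * b i) * y i)
        = of_int (- b k) * (\<Sum>i\<in>I. of_int (a i) * y i) + of_int (a k) * (\<Sum>i\<in>I. of_int (b i) * y i)"
      by (simp add: sum_distrib_left sum.distrib[symmetric] algebra_simps)
    finally have "of_int (- b k) * f (l, a) + of_int (a k) * f (m, b) < 0"
      by (simp add: f_def algebra_simps)
    with pos show ?thesis
      unfolding u(2) w(2) bd_def by (simp add: divide_simps) (simp add: algebra_simps)
  qed
  obtain z where z: "z \<in> L" "\<And>x. x \<in> Lo \<Longrightarrow> bd x < z" "\<And>x. x \<in> Up \<Longrightarrow> z < bd x"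
    using between_finite[OF finite_imageI[OF fin(2)] finite_imageI[OF fin(1)] bounds, of bd bd]
    by auto
  have "l + (\<Sum>i\<in>insert k I. of_int (a i) * (y(k := z)) i) < 0" if mem: "(l, a) \<in> F" for l a
  proof -
    have "(\<Sum>i\<in>insert k I. of_int (a i) * (y(k := z)) i)
        = of_int (a k) * z + (\<Sum>i\<in>I. of_int (a i) * (y(k := z)) i)"
      using insert.hyps by simp
    also have "(\<Sum>i\<in>I. of_int (a i) * (y(k := z)) i) = (\<Sum>i\<in>I. of_int (a i) * y i)"
      using insert.hyps by (intro sum.cong) auto
    finally have eq: "l + (\<Sum>i\<in>insert k I. of_int (a i) * (y(k := z)) i) = of_int (a k) * z + f (l, a)"
      by (simp add: f_def)
    consider "a k = 0" | "a k > 0" | "a k < 0" by linarith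
    then show ?thesis
    proof cases
      case 1
      then show ?thesis using sol[of l a] mem unfolding eq by (simp add: F'_def f_def)
    next
      case 2
      then have "z < bd (l, a)" using z(3) mem by (simp add: Up_def)
      with 2 show ?thesis unfolding eq by (simp add: bd_def field_simps)
    next
      case 3
      then have "bd (l, a) < z" using z(2) mem by (simp add: Lo_def)
      with 3 show ?thesis unfolding eq by (simp add: bd_def field_simps)
    qed
  qed
  moreover have "\<forall>i. (y(k := z)) i \<in> L" using y z(1) by simp
  ultimately show ?case by blast
qed

section \<open>Relations and changes of generators\<close>

lemma E_int_mult:
  assumes "E l a"
  shows "P (of_int k * l) (\<lambda>i. k * a i)"
  using assms P_nat_mult[of l a "nat k"] P_nat_mult[of "- l" "\<lambda>i. - a i" "nat (- k)"]
  by (cases "k \<ge> 0") auto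

text \<open>Both the vanishing form and its negative are available to \<open>P_add\<close>. This is
  how relations are used to rewrite comparisons.\<close>

lemma P_shift:
  assumes "E m b"
  shows "P (l + m) (\<lambda>i. a i + b i) \<longleftrightarrow> P l a"
  using assms P_add[of l a m b] P_add[of "l + m" "\<lambda>i. a i + b i" "- m" "\<lambda>i. - b i"] by auto

text \<open>In terms of the elements \<open>x i\<close>, this is the cone of the family in which
  \<open>x j\<close> is replaced by \<open>x j + e * x i\<close>. The coefficients are substituted
  linearly, so each condition is inherited from \<open>P\<close>.\<close>

lemma shear:
  "pure_cone L (\<lambda>l a. P l (a(i := a i + e * a j)))"
proof unfold_locales
  fix l m a b
  assume "P l (a(i := a i + e * a j))" "P m (b(i := b i + e * b j))"
  from P_add[OF this] show "P (l + m) ((\<lambda>k. a k + b k)(i := a i + b i + e * (a j + b j)))"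
    by (rule back_subst[of "P (l + m)"]) (auto simp: fun_eq_iff algebra_simps)
next
  fix l a
  assume "l \<in> L"
  have "(\<lambda>k. - a k)(i := - a i + e * - a j) = (\<lambda>k. - (a(i := a i + e * a j)) k)"
    by auto
  with P_total[OF \<open>l \<in> L\<close>, of "a(i := a i + e * a j)"]
  show "P l (a(i := a i + e * a j)) \<or> P (- l) ((\<lambda>k. - a k)(i := - a i + e * - a j))"
    by simp
next
  fix l
  assume "l \<in> L"
  have "(\<lambda>k. 0)(i := 0 + e * 0) = (\<lambda>k. 0 :: int)" by auto
  with P_const[OF \<open>l \<in> L\<close>] show "P l ((\<lambda>k. 0)(i := 0 + e * 0)) = (l \<le> 0)" by metis
next
  fix l a and n :: nat
  assume l: "l \<in> L" "n > 0" and
    "P l ((\<lambda>k. int n * a k)(i := int n * a i + e * (int n * a j)))"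
    "P (- l) ((\<lambda>k. - (int n * a k))(i := - (int n * a i) + e * - (int n * a j)))"
  moreover have "(\<lambda>k. int n * a k)(i := int n * a i + e * (int n * a j))
      = (\<lambda>k. int n * (a(i := a i + e * a j)) k)"
    by (auto simp: algebra_simps)
  moreover have "(\<lambda>k. - (int n * a k))(i := - (int n * a i) + e * - (int n * a j))
      = (\<lambda>k. - (int n * (a(i := a i + e * a j)) k))"
    by (auto simp: algebra_simps)
  ultimately show "l / n \<in> L"
    using P_pure[OF l] by metis
qed

end

text \<open>The point \<open>y\<close> has to reproduce the truth value of every comparison in
  \<open>T\<close>, the false ones included; this is what makes negations harmless later.
  \<open>P\<close> is an argument because the induction on the generators passes to other
  cones.\<close>

definition cone_solvable :: "real set \<Rightarrow> (real \<Rightarrow> ('i \<Rightarrow> int) \<Rightarrow> bool) \<Rightarrow> 'i set \<Rightarrow> bool" where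
  "cone_solvable L P I \<longleftrightarrow> (\<forall>T. finite T \<longrightarrow>
     (\<forall>(l, a)\<in>T. l \<in> L \<and> (\<forall>i. i \<notin> I \<longrightarrow> a i = 0)) \<longrightarrow>
     (\<exists>y. (\<forall>i. y i \<in> L) \<and> (\<forall>(l, a)\<in>T. P l a \<longleftrightarrow> l + (\<Sum>i\<in>I. of_int (a i) * y i) \<le> 0)))"

lemma cone_solvableI:
  assumes "\<And>T. \<lbrakk>finite T; \<And>l a. (l, a) \<in> T \<Longrightarrow> l \<in> L;
      \<And>l a i. \<lbrakk>(l, a) \<in> T; i \<notin> I\<rbrakk> \<Longrightarrow> a i = 0\<rbrakk>
    \<Longrightarrow> \<exists>y. (\<forall>i. y i \<in> L) \<and> (\<forall>(l, a)\<in>T. P l a \<longleftrightarrow> l + (\<Sum>i\<in>I. of_int (a i) * y i) \<le> 0)"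
  shows "cone_solvable L P I"
  unfolding cone_solvable_def
  by (intro allI impI assms) auto

lemma cone_solvableE:
  assumes "cone_solvable L P I" "finite T"
    and "\<And>l a. (l, a) \<in> T \<Longrightarrow> l \<in> L" "\<And>l a i. \<lbrakk>(l, a) \<in> T; i \<notin> I\<rbrakk> \<Longrightarrow> a i = 0"
  obtains y where "\<And>i. y i \<in> L"
    "\<And>l a. (l, a) \<in> T \<Longrightarrow> P l a \<longleftrightarrow> l + (\<Sum>i\<in>I. of_int (a i) * y i) \<le> 0"
proof -
  have "\<forall>(l, a)\<in>T. l \<in> L \<and> (\<forall>i. i \<notin> I \<longrightarrow> a i = 0)"
    using assms(3,4) by blast
  then have "\<exists>y. (\<forall>i. y i \<in> L) \<and> (\<forall>(l, a)\<in>T. P l a \<longleftrightarrow> l + (\<Sum>i\<in>I. of_int (a i) * y i) \<le> 0)"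
    using assms(1,2) unfolding cone_solvable_def by blast
  then show ?thesis using that by fast
qed

text \<open>Without a nontrivial relation, each comparison is strict in one direction unless its
  form is a constant that vanishes. The strict ones are left to \<open>strict_solution\<close>, the
  constants to \<open>P_const\<close>.\<close>

lemma (in pure_cone) solvable_if_independent:
  assumes "finite I"
    and indep: "\<And>l a. \<lbrakk>l \<in> L; E l a; \<And>i. i \<notin> I \<Longrightarrow> a i = 0\<rbrakk> \<Longrightarrow> a = (\<lambda>i. 0)"
  shows "cone_solvable L P I"
proof (rule cone_solvableI)
  fix T :: "(real \<times> ('i \<Rightarrow> int)) set"
  assume T: "finite T" "\<And>l a. (l, a) \<in> T \<Longrightarrow> l \<in> L"
    "\<And>l a i. \<lbrakk>(l, a) \<in> T; i \<notin> I\<rbrakk> \<Longrightarrow> a i = 0"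
  \<comment> \<open>Each form of \<open>T\<close> enters with the sign that makes it negative, so a
    solution of \<open>F\<close> also refutes the comparisons that fail for
    \<open>P\<close>.\<close>
  define F where "F = {x \<in> T \<union> (\<lambda>(l, a). (- l, \<lambda>i. - a i)) ` T. S (fst x) (snd x)}"
  have "l \<in> L \<and> (\<forall>i. i \<notin> I \<longrightarrow> a i = 0) \<and> S l a" if "(l, a) \<in> F" for l a
    using that T(2,3) minus by (force simp: F_def)
  moreover have "finite F" using T(1) by (simp add: F_def)
  ultimately obtain y where y: "\<forall>i. y i \<in> L"
    and sol: "\<And>l a. (l, a) \<in> F \<Longrightarrow> l + (\<Sum>i\<in>I. of_int (a i) * y i) < 0"
    using strict_solution[OF assms(1), of F] by blast
  have "P l a \<longleftrightarrow> l + (\<Sum>i\<in>I. of_int (a i) * y i) \<le> 0" if mem: "(l, a) \<in> T" for l a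
  proof -
    have lL: "l \<in> L" using T(2) mem .
    consider "S l a" | "\<not> P l a" | "E l a" by blast
    then show ?thesis
    proof cases
      case 1
      then have "(l, a) \<in> F" using mem by (auto simp: F_def)
      from sol[OF this] show ?thesis using P_total[OF lL, of a] 1 by simp
    next
      case 2
      then have "(- l, \<lambda>i. - a i) \<in> F" using mem by (force simp: F_def)
      from sol[OF this] show ?thesis using 2 by (simp add: sum_negf)
    next
      case 3
      then have a: "a = (\<lambda>i. 0)" using indep[OF lL] T(3)[OF mem] by blast
      then show ?thesis using P_const[OF lL] by simp
    qed
  qed
  then show "\<exists>y. (\<forall>i. y i \<in> L) \<and> (\<forall>(l, a)\<in>T. P l a \<longleftrightarrow> l + (\<Sum>i\<in>I. of_int (a i) * y i) \<le> 0)"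
    using y by (intro exI[of _ y]) auto
qed

text \<open>Purity turns a relation in a single generator into a value in \<open>L\<close> of that generator.\<close>

lemma (in pure_cone) solvable_if_generator_torsion:
  assumes "finite I" "i \<in> I" and l0: "l0 \<in> L" and n: "n > 0"
    and E0: "E l0 (\<lambda>j. if j = i then int n else 0)"
    and IH: "cone_solvable L P (I - {i})"
  shows "cone_solvable L P I"
proof (rule cone_solvableI)
  fix T :: "(real \<times> ('i \<Rightarrow> int)) set"
  assume T: "finite T" "\<And>l a. (l, a) \<in> T \<Longrightarrow> l \<in> L"
    "\<And>l a j. \<lbrakk>(l, a) \<in> T; j \<notin> I\<rbrakk> \<Longrightarrow> a j = 0"
  define d where "d = (\<lambda>j. if j = i then 1 else 0 :: int)"
  define m where "m = l0 / real n"
  have d: "(\<lambda>j. if j = i then int n else 0) = (\<lambda>j. int n * d j)" by (auto simp: d_def)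
  have dm: "(\<lambda>j. - (if j = i then int n else 0)) = (\<lambda>j. - (int n * d j))" by (auto simp: d_def)
  have mL: "m \<in> L" unfolding m_def using P_pure[OF l0 n, of d] E0 unfolding dm d by blast
  have nm: "real n * m = l0" using n by (simp add: m_def)
  \<comment> \<open>Torsion-freeness: if the form given by \<open>m\<close> and \<open>d\<close>
    were strictly positive or negative, so would be its \<open>n\<close>-fold multiple, against
    \<open>E0\<close>.\<close>
  have Em: "E m d"
  proof (rule ccontr)
    assume "\<not> E m d"
    then have "S m d \<or> S (- m) (\<lambda>j. - d j)" by auto
    then have "S (real n * m) (\<lambda>j. int n * d j) \<or> S (real n * - m) (\<lambda>j. int n * - d j)"
      using S_int_mult[OF mL, of d "int n"] S_int_mult[OF minus[OF mL], of "\<lambda>j. - d j" "int n"] n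
      by force
    then show False using E0 unfolding dm d by (simp add: nm)
  qed
  \<comment> \<open>Substitution of \<open>- m\<close> for the generator \<open>i\<close>, the value
    that the relation \<open>Em\<close> dictates; \<open>y'\<close> assigns the same value.\<close>
  define red where "red = (\<lambda>(l, a). (l - of_int (a i) * m, a(i := 0 :: int)))"
  have red: "P l a \<longleftrightarrow> P (l - of_int (a i) * m) (a(i := 0))" for l and a :: "'i \<Rightarrow> int"
  proof -
    have "E (of_int (a i) * m) (\<lambda>j. a i * d j)"
      using E_int_mult[OF Em, of "a i"] E_int_mult[OF Em, of "- a i"] by simp
    from P_shift[OF this, of "l - of_int (a i) * m" "a(i := 0)"]
    have "P (l - of_int (a i) * m) (a(i := 0)) \<longleftrightarrow> P l (\<lambda>j. (a(i := 0)) j + a i * d j)"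
      by simp
    also have "(\<lambda>j. (a(i := 0)) j + a i * d j) = a" by (auto simp: d_def)
    finally show ?thesis ..
  qed
  obtain y where y: "\<And>j. y j \<in> L"
    and sol: "\<And>l a. (l, a) \<in> red ` T \<Longrightarrow> P l a \<longleftrightarrow> l + (\<Sum>j\<in>I - {i}. of_int (a j) * y j) \<le> 0"
  proof (rule cone_solvableE[OF IH])
    show "finite (red ` T)" using T(1) by simp
    show "l \<in> L" if "(l, a) \<in> red ` T" for l a
      using that T(2) mL by (auto simp: red_def intro!: diff int_mult)
    show "a j = 0" if "(l, a) \<in> red ` T" "j \<notin> I - {i}" for l a j
      using that T(3) by (auto simp: red_def)
  qed blast
  define y' where "y' = y(i := - m)"
  have "P l a \<longleftrightarrow> l + (\<Sum>j\<in>I. of_int (a j) * y' j) \<le> 0" if "(l, a) \<in> T" for l a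
  proof -
    have "red (l, a) \<in> red ` T" using that by blast
    then have "P l a \<longleftrightarrow> l - of_int (a i) * m + (\<Sum>j\<in>I - {i}. of_int ((a(i := 0)) j) * y j) \<le> 0"
      unfolding red[of l a] by (intro sol) (simp add: red_def)
    also have "(\<Sum>j\<in>I - {i}. of_int ((a(i := 0)) j) * y j) = (\<Sum>j\<in>I - {i}. of_int (a j) * y' j)"
      by (intro sum.cong) (auto simp: y'_def)
    also have "l - of_int (a i) * m + \<dots> = l + (\<Sum>j\<in>I. of_int (a j) * y' j)"
      using assms(1,2) by (simp add: sum.remove[of I i] y'_def)
    finally show ?thesis .
  qed
  moreover have "\<forall>j. y' j \<in> L" using y minus[OF mL] by (simp add: y'_def)
  ultimately show "\<exists>y. (\<forall>i. y i \<in> L) \<and> (\<forall>(l, a)\<in>T. P l a \<longleftrightarrow> l + (\<Sum>i\<in>I. of_int (a i) * y i) \<le> 0)"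
    by blast
qed

text \<open>A solution \<open>y\<close> for the sheared cone gives \<open>y j\<close> to the new
  generator \<open>x j + e * x i\<close>, so the old \<open>x j\<close> receives
  \<open>y j - e * y i\<close>. The inverse shear \<open>sh\<close> rewrites the comparisons
  accordingly.\<close>

lemma (in pure_cone) solvable_shear:
  assumes "finite I" "i \<in> I" "j \<in> I" "i \<noteq> j"
    and sheared: "cone_solvable L (\<lambda>l a. P l (a(i := a i + e * a j))) I"
  shows "cone_solvable L P I"
proof (rule cone_solvableI)
  fix T :: "(real \<times> ('i \<Rightarrow> int)) set"
  assume T: "finite T" "\<And>l a. (l, a) \<in> T \<Longrightarrow> l \<in> L"
    "\<And>l a k. \<lbrakk>(l, a) \<in> T; k \<notin> I\<rbrakk> \<Longrightarrow> a k = 0"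
  define sh where "sh = (\<lambda>(l :: real, a). (l, a(i := a i - e * a j)))"
  obtain y where y: "\<And>k. y k \<in> L"
    and sol: "\<And>l a. (l, a) \<in> sh ` T \<Longrightarrow>
      P l (a(i := a i + e * a j)) \<longleftrightarrow> l + (\<Sum>k\<in>I. of_int (a k) * y k) \<le> 0"
  proof (rule cone_solvableE[OF sheared])
    show "finite (sh ` T)" using T(1) by simp
    show "l \<in> L" if "(l, a) \<in> sh ` T" for l a
      using that T(2) by (auto simp: sh_def)
    show "a k = 0" if "(l, a) \<in> sh ` T" "k \<notin> I" for l a k
      using that T(3) assms(2) by (auto simp: sh_def)
  qed blast
  define y' where "y' = y(j := y j - of_int e * y i)"
  have "P l a \<longleftrightarrow> l + (\<Sum>k\<in>I. of_int (a k) * y' k) \<le> 0" if "(l, a) \<in> T" for l a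
  proof -
    define a' where "a' = a(i := a i - e * a j)"
    have "(l, a') \<in> sh ` T" using that by (force simp: sh_def a'_def)
    from sol[OF this] have "P l (a'(i := a' i + e * a' j)) \<longleftrightarrow> l + (\<Sum>k\<in>I. of_int (a' k) * y k) \<le> 0" .
    moreover have "a'(i := a' i + e * a' j) = a" using assms(4) by (auto simp: a'_def)
    moreover have "(\<Sum>k\<in>I. of_int (a' k) * y k) = (\<Sum>k\<in>I. of_int (a k) * y' k)"
    proof -
      have I: "I = insert i (insert j (I - {i, j}))" using assms(2,3) by blast
      have rest: "(\<Sum>k\<in>I - {i, j}. of_int (a' k) * y k) = (\<Sum>k\<in>I - {i, j}. of_int (a k) * y' k)"
        by (intro sum.cong) (auto simp: a'_def y'_def)
      show ?thesis
        using assms(1,4) by (subst (1 2) I) (simp add: rest, simp add: a'_def y'_def algebra_simps)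
    qed
    ultimately show ?thesis by simp
  qed
  moreover have "\<forall>k. y' k \<in> L"
    using y by (auto simp: y'_def intro!: diff int_mult)
  ultimately show "\<exists>y. (\<forall>i. y i \<in> L) \<and> (\<forall>(l, a)\<in>T. P l a \<longleftrightarrow> l + (\<Sum>i\<in>I. of_int (a i) * y i) \<le> 0)"
    by blast
qed

text \<open>The Euclidean algorithm on the exponents of a relation between the generators.\<close>

lemma solvable_if_dependent:
  fixes I :: "'i set"
  assumes "finite I"
    and IH: "\<And>(P :: real \<Rightarrow> ('i \<Rightarrow> int) \<Rightarrow> bool) i. \<lbrakk>pure_cone L P; i \<in> I\<rbrakk> \<Longrightarrow> cone_solvable L P (I - {i})"
  shows "\<lbrakk>pure_cone L P; l \<in> L; P l a; P (- l) (\<lambda>i. - a i); \<And>i. i \<notin> I \<Longrightarrow> a i = 0;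
    a \<noteq> (\<lambda>i. 0)\<rbrakk> \<Longrightarrow> cone_solvable L P I"
proof (induction "\<Sum>i\<in>I. nat \<bar>a i\<bar>" arbitrary: P a rule: less_induct)
  case less
  interpret pure_cone L P by (fact less.prems(1))
  obtain i0 where i0: "a i0 \<noteq> 0" using less.prems(6) by auto
  then have i0I: "i0 \<in> I" using less.prems(5) by blast
  show ?case
  proof (cases "\<exists>j\<in>I. j \<noteq> i0 \<and> a j \<noteq> 0")
    case True
    then obtain i j where ij: "i \<in> I" "j \<in> I" "i \<noteq> j" "a j \<noteq> 0" "\<bar>a j\<bar> \<le> \<bar>a i\<bar>"
      using i0 i0I by (metis linorder_le_cases)
    \<comment> \<open>One subtractive step of Euclid's algorithm: with this sign
      \<open>\<bar>a' i\<bar> = \<bar>a i\<bar> - \<bar>a j\<bar>\<close>, which is smaller since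
      \<open>a j\<close> is nonzero. The vector \<open>a'\<close> expresses the same relation over
      the sheared generators.\<close>
    define e where "e = sgn (a i) * sgn (a j)"
    define a' where "a' = a(i := a i - e * a j)"
    have aa: "a'(i := a' i + e * a' j) = a" using ij(3) by (auto simp: a'_def)
    have smaller: "\<bar>a' i\<bar> < \<bar>a i\<bar>"
      using ij(4,5) by (auto simp: a'_def e_def sgn_if)
    have "cone_solvable L (\<lambda>l b. P l (b(i := b i + e * b j))) I"
    proof (rule less.hyps[of a'])
      have "(\<Sum>k\<in>I - {i}. nat \<bar>a' k\<bar>) = (\<Sum>k\<in>I - {i}. nat \<bar>a k\<bar>)"
        by (intro sum.cong) (auto simp: a'_def)
      then show "(\<Sum>k\<in>I. nat \<bar>a' k\<bar>) < (\<Sum>k\<in>I. nat \<bar>a k\<bar>)"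
        using smaller assms(1) ij(1) by (simp add: sum.remove[of I i])
      show "pure_cone L (\<lambda>l b. P l (b(i := b i + e * b j)))" by (rule shear)
      show "P l (a'(i := a' i + e * a' j))" using less.prems(3) by (simp add: aa)
      have "(\<lambda>k. - a' k)(i := - a' i + e * - a' j) = (\<lambda>k. - (a'(i := a' i + e * a' j)) k)"
        by auto
      then show "P (- l) ((\<lambda>k. - a' k)(i := - a' i + e * - a' j))"
        using less.prems(4) by (simp add: aa)
      show "a' k = 0" if "k \<notin> I" for k
        using that less.prems(5) ij(1) by (auto simp: a'_def)
      have "a' j \<noteq> 0" using ij by (simp add: a'_def)
      then show "a' \<noteq> (\<lambda>i. 0)" by auto
    qed (fact less.prems(2))
    then show ?thesis by (rule solvable_shear[OF assms(1) ij(1-3)])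
  next
    case False
    then have a0: "a j = 0" if "j \<noteq> i0" for j using less.prems(5) that by blast
    \<comment> \<open>Only the coefficient at \<open>i0\<close> is left. The relation is negated if
      necessary to make this coefficient a positive \<open>n\<close>.\<close>
    define l0 where "l0 = (if a i0 > 0 then l else - l)"
    have "l0 \<in> L" using less.prems(2) minus by (simp add: l0_def)
    define b where "b = (\<lambda>j. if j = i0 then int (nat \<bar>a i0\<bar>) else 0)"
    have "E l0 b"
    proof (cases "a i0 > 0")
      case True
      then have "b = a" using a0 by (auto simp: fun_eq_iff b_def)
      then show ?thesis using less.prems(3,4) True by (simp add: l0_def)
    next
      case neg: False
      then have "b = (\<lambda>j. - a j)" using a0 by (auto simp: fun_eq_iff b_def)
      then show ?thesis using less.prems(3,4) neg by (simp add: l0_def)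
    qed
    then show ?thesis
      using i0
      unfolding b_def
      by (intro solvable_if_generator_torsion[OF assms(1) i0I \<open>l0 \<in> L\<close> _ _ IH[OF less.prems(1) i0I],
            where n = "nat \<bar>a i0\<bar>"]) auto
  qed
qed

text \<open>Induction on the number of generators, uniformly in \<open>P\<close>, since the shears
  change the cone: a relation makes it possible to eliminate a generator, and without relations only
  strict constraints matter.\<close>

lemma pure_cone_solvable:
  fixes P :: "real \<Rightarrow> ('i \<Rightarrow> int) \<Rightarrow> bool"
  assumes "finite I" "pure_cone L P"
  shows "cone_solvable L P I"
  using assms
proof (induction "card I" arbitrary: I P)
  case 0
  interpret pure_cone L P by fact
  show ?case using 0 by (intro solvable_if_independent) auto
next
  case (Suc n)
  interpret pure_cone L P by fact
  show ?case
  proof (cases "\<exists>l a. l \<in> L \<and> E l a \<and> (\<forall>i. i \<notin> I \<longrightarrow> a i = 0) \<and> a \<noteq> (\<lambda>i. 0)")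
    case True
    then obtain l a where la: "l \<in> L" "E l a" "\<And>i. i \<notin> I \<Longrightarrow> a i = 0" "a \<noteq> (\<lambda>i. 0)" by blast
    show ?thesis
    proof (rule solvable_if_dependent[OF Suc.prems(1), where P = P and l = l and a = a])
      show "cone_solvable L Q (I - {i})" if "pure_cone L Q" "i \<in> I"
        for Q :: "real \<Rightarrow> ('i \<Rightarrow> int) \<Rightarrow> bool" and i
        using Suc.hyps(1)[of "I - {i}" Q] Suc.hyps(2) Suc.prems(1) that by auto
    qed (use la Suc.prems(2) in auto)
  next
    case False
    then show ?thesis using Suc.prems(1) by (intro solvable_if_independent) auto
  qed
qed

section \<open>Chains of rational product algebras\<close>

definition log_rats :: "real set" where
  "log_rats = ln ` {x \<in> \<rat>. 0 < x}"

lemma log_ratsI: "\<lbrakk>x \<in> \<rat>; 0 < x\<rbrakk> \<Longrightarrow> ln x \<in> log_rats"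
  by (auto simp: log_rats_def)

lemma exp_log_rats: "l \<in> log_rats \<Longrightarrow> exp l \<in> \<rat>"
  by (auto simp: log_rats_def)

lemma dense_subgroup_log_rats: "dense_subgroup log_rats"
proof
  show "0 \<in> log_rats" using log_ratsI[of 1] by simp
  show "x + y \<in> log_rats" if "x \<in> log_rats" "y \<in> log_rats" for x y
    using log_ratsI[of "exp x * exp y"] exp_log_rats that by (simp add: ln_mult)
  show "- x \<in> log_rats" if "x \<in> log_rats" for x
    using log_ratsI[of "inverse (exp x)"] exp_log_rats that by (simp add: ln_inverse)
  show "\<exists>z\<in>log_rats. x < z \<and> z < y" if xy: "x < y" for x y :: real
  proof -
    obtain r where r: "r \<in> \<rat>" "exp x < r" "r < exp y"
      using Rats_dense_in_real[of "exp x" "exp y"] xy by auto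
    then have "0 < r" using exp_gt_zero less_trans by blast
    then have "x < ln r" "ln r < y"
      using r by (metis exp_less_cancel_iff exp_ln)+
    then show ?thesis
      using log_ratsI[OF r(1) \<open>0 < r\<close>] by blast
  qed
qed

text \<open>Nontriviality is assumed for a single constant only, so that the locale covers the
  axiomatization with just one \<open>q\<close>.\<close>

locale product_chain =
  fixes A :: "'a rpa_struct"
  assumes RPA: "A \<in> RPA"
    and linear: "\<lbrakk>x \<in> carrier A; y \<in> carrier A\<rbrakk> \<Longrightarrow> bl_le A x y \<or> bl_le A y x"
    and nontrivial: "\<exists>q\<in>open_unit_rats. cst A q \<noteq> top_el A"
begin

abbreviation mul (infixl "\<cdot>" 70) where "x \<cdot> y \<equiv> mult A x y"
abbreviation imp (infixr "\<rightharpoonup>" 60) where "x \<rightharpoonup> y \<equiv> resid A x y"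
abbreviation le (infix "\<sqsubseteq>" 50) where "x \<sqsubseteq> y \<equiv> bl_le A x y"
abbreviation "C \<equiv> carrier A"
abbreviation "tp \<equiv> top_el A"
abbreviation "bt \<equiv> bot_el A"
abbreviation "M \<equiv> carrier A - {bot_el A}"

lemma bl: "bl_algebra A" and bl_structure: "bl_structure A"
  using RPA by (auto simp: RPA_def product_algebra_def rpa_structure_def)

lemma closed [simp]:
  "bt \<in> C" "tp \<in> C"
  "\<lbrakk>x \<in> C; y \<in> C\<rbrakk> \<Longrightarrow> x \<cdot> y \<in> C"
  "\<lbrakk>x \<in> C; y \<in> C\<rbrakk> \<Longrightarrow> x \<rightharpoonup> y \<in> C"
  "\<lbrakk>x \<in> C; y \<in> C\<rbrakk> \<Longrightarrow> meet A x y \<in> C"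
  "\<lbrakk>x \<in> C; y \<in> C\<rbrakk> \<Longrightarrow> join A x y \<in> C"
  using bl_structure by (auto simp: bl_structure_def)

lemma cst_closed [simp]: "cst A q \<in> C"
  using RPA by (auto simp: RPA_def rpa_structure_def)

lemma mul_assoc: "\<lbrakk>x \<in> C; y \<in> C; z \<in> C\<rbrakk> \<Longrightarrow> x \<cdot> y \<cdot> z = x \<cdot> (y \<cdot> z)"
  and mul_comm: "\<lbrakk>x \<in> C; y \<in> C\<rbrakk> \<Longrightarrow> x \<cdot> y = y \<cdot> x"
  and mul_top [simp]: "x \<in> C \<Longrightarrow> x \<cdot> tp = x"
  using bl by (auto simp: bl_algebra_def bl_comm_monoid_def)

lemma top_mul [simp]: "x \<in> C \<Longrightarrow> tp \<cdot> x = x"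
  using mul_comm[of tp x] by simp

lemma mul_left_comm: "\<lbrakk>x \<in> C; y \<in> C; z \<in> C\<rbrakk> \<Longrightarrow> x \<cdot> (y \<cdot> z) = y \<cdot> (x \<cdot> z)"
  by (metis mul_assoc mul_comm)

lemmas mul_ac = mul_assoc mul_comm mul_left_comm

lemma meet_comm: "\<lbrakk>x \<in> C; y \<in> C\<rbrakk> \<Longrightarrow> meet A x y = meet A y x"
  and join_comm: "\<lbrakk>x \<in> C; y \<in> C\<rbrakk> \<Longrightarrow> join A x y = join A y x"
  and absorb: "\<lbrakk>x \<in> C; y \<in> C\<rbrakk> \<Longrightarrow> meet A x (join A x y) = x"
    "\<lbrakk>x \<in> C; y \<in> C\<rbrakk> \<Longrightarrow> join A x (meet A x y) = x"
  and meet_assoc: "\<lbrakk>x \<in> C; y \<in> C; z \<in> C\<rbrakk> \<Longrightarrow> meet A (meet A x y) z = meet A x (meet A y z)"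
  and bot_le [simp]: "x \<in> C \<Longrightarrow> bt \<sqsubseteq> x"
  and le_top [simp]: "x \<in> C \<Longrightarrow> x \<sqsubseteq> tp"
  using bl by (auto simp: bl_algebra_def bl_bounded_lattice_def)

lemma le_refl [simp]: "x \<in> C \<Longrightarrow> x \<sqsubseteq> x"
  using linear by blast

lemma le_antisym: "\<lbrakk>x \<sqsubseteq> y; y \<sqsubseteq> x; x \<in> C; y \<in> C\<rbrakk> \<Longrightarrow> x = y"
  unfolding bl_le_def using meet_comm by metis

lemma le_trans: "\<lbrakk>x \<sqsubseteq> y; y \<sqsubseteq> z; x \<in> C; y \<in> C; z \<in> C\<rbrakk> \<Longrightarrow> x \<sqsubseteq> z"
  unfolding bl_le_def using meet_assoc by metis

lemma meet_eq: "\<lbrakk>x \<in> C; y \<in> C\<rbrakk> \<Longrightarrow> meet A x y = (if x \<sqsubseteq> y then x else y)"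
  using linear[of x y] meet_comm[of x y] by (auto simp: bl_le_def)

lemma join_eq: "\<lbrakk>x \<in> C; y \<in> C\<rbrakk> \<Longrightarrow> join A x y = (if x \<sqsubseteq> y then y else x)"
  using linear[of x y] absorb(2)[of x y] absorb(2)[of y x] join_comm[of x y] meet_comm[of x y]
  by (auto simp: bl_le_def)

lemma residuation: "\<lbrakk>x \<in> C; y \<in> C; z \<in> C\<rbrakk> \<Longrightarrow> x \<cdot> y \<sqsubseteq> z \<longleftrightarrow> x \<sqsubseteq> y \<rightharpoonup> z"
  and meet_imp: "\<lbrakk>x \<in> C; y \<in> C\<rbrakk> \<Longrightarrow> meet A x y = x \<cdot> (x \<rightharpoonup> y)"
  using bl by (auto simp: bl_algebra_def)

lemma mul_imp: "\<lbrakk>y \<sqsubseteq> x; x \<in> C; y \<in> C\<rbrakk> \<Longrightarrow> x \<cdot> (x \<rightharpoonup> y) = y"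
  using meet_imp[of x y] meet_comm[of x y] by (simp add: bl_le_def)

lemma top_le: "x \<in> C \<Longrightarrow> tp \<sqsubseteq> x \<longleftrightarrow> x = tp"
  using le_antisym le_top le_refl closed(2) by metis

lemma le_bot: "x \<in> C \<Longrightarrow> x \<sqsubseteq> bt \<longleftrightarrow> x = bt"
  using le_antisym bot_le le_refl closed(1) by metis

lemma imp_eq_top: "\<lbrakk>x \<in> C; y \<in> C\<rbrakk> \<Longrightarrow> x \<rightharpoonup> y = tp \<longleftrightarrow> x \<sqsubseteq> y"
  using residuation[of tp x y] top_le[of "x \<rightharpoonup> y"] by simp

lemma mul_mono:
  assumes "x \<sqsubseteq> y" "x \<in> C" "y \<in> C" "z \<in> C"
  shows "x \<cdot> z \<sqsubseteq> y \<cdot> z"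
proof -
  have "y \<sqsubseteq> z \<rightharpoonup> y \<cdot> z" using residuation[of y z "y \<cdot> z"] assms by simp
  then have "x \<sqsubseteq> z \<rightharpoonup> y \<cdot> z" using assms le_trans[of x y "z \<rightharpoonup> y \<cdot> z"] by simp
  then show ?thesis using residuation[of x z "y \<cdot> z"] assms by simp
qed

lemma mul_mono2:
  assumes "x \<sqsubseteq> y" "z \<sqsubseteq> w" "x \<in> C" "y \<in> C" "z \<in> C" "w \<in> C"
  shows "x \<cdot> z \<sqsubseteq> y \<cdot> w"
proof -
  have "x \<cdot> z \<sqsubseteq> y \<cdot> z" "y \<cdot> z \<sqsubseteq> y \<cdot> w"
    using mul_mono[of x y z] mul_mono[of z w y] assms mul_comm[of y] by auto
  then show ?thesis using le_trans assms closed(3) by blast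
qed

lemma mul_le: "\<lbrakk>x \<in> C; y \<in> C\<rbrakk> \<Longrightarrow> x \<cdot> y \<sqsubseteq> x"
  using mul_mono2[of x x y tp] by simp

section \<open>Cancellation from identities of the standard algebra\<close>

lemma identity: "\<lbrakk>bl_identity_holds std_product_algebra s t; \<And>i. v i \<in> C\<rbrakk>
    \<Longrightarrow> bl_eval A v s = bl_eval A v t"
  using RPA by (auto simp: RPA_def product_algebra_def bl_identity_holds_def)

text \<open>Product algebras satisfy the identity that the meet of \<open>x\<close> with its
  negation is 0. In a chain the meet is one of the two, and \<open>x\<close> is not bottom.\<close>

lemma imp_bot:
  assumes "x \<in> M"
  shows "x \<rightharpoonup> bt = bt"
proof -
  have "bl_identity_holds std_product_algebra (BMeet (BVar 0) (BResid (BVar 0) BZero)) BZero"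
    by (auto simp: bl_identity_holds_def std_product_algebra_def prod_imp_def min_def intro: antisym)
  from identity[OF this, of "\<lambda>_. x"] have "meet A x (x \<rightharpoonup> bt) = bt"
    using assms by simp
  then show ?thesis using assms meet_eq[of x "x \<rightharpoonup> bt"] by (simp split: if_splits)
qed

text \<open>Cancellation holds only for nonzero \<open>x\<close>, so as an identity it needs a
  guard: the double negation of \<open>x\<close>, which is 0 at 0 and 1 elsewhere. By
  \<open>imp_bot\<close> the guard evaluates to top here.\<close>

lemma mul_le_cancel:
  assumes "x \<in> M" "y \<in> C" "z \<in> C"
  shows "x \<cdot> y \<sqsubseteq> x \<cdot> z \<longleftrightarrow> y \<sqsubseteq> z"
proof
  let ?x = "BVar 0" and ?y = "BVar 1" and ?z = "BVar 2"
  have "bl_identity_holds std_product_algebra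
    (BResid (BResid (BResid ?x BZero) BZero)
      (BResid (BResid (BMult ?x ?y) (BMult ?x ?z)) (BResid ?y ?z))) BOne"
    unfolding bl_identity_holds_def
  proof (intro allI impI)
    fix v :: "nat \<Rightarrow> real"
    assume "\<forall>i. v i \<in> carrier std_product_algebra"
    then have "0 \<le> v 0" "0 \<le> v 1" "0 \<le> v 2" "v 0 \<le> 1" "v 1 \<le> 1" "v 2 \<le> 1"
      by (auto simp: std_product_algebra_def)
    then show "bl_eval std_product_algebra v
      (BResid (BResid (BResid ?x BZero) BZero)
        (BResid (BResid (BMult ?x ?y) (BMult ?x ?z)) (BResid ?y ?z))) = bl_eval std_product_algebra v BOne"
      by (cases "v 0 = 0") (auto simp: std_product_algebra_def prod_imp_def)
  qed
  from identity[OF this, of "\<lambda>i. if i = 0 then x else if i = 1 then y else z"]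
  have "tp \<rightharpoonup> ((x \<cdot> y \<rightharpoonup> x \<cdot> z) \<rightharpoonup> (y \<rightharpoonup> z)) = tp"
    using assms imp_bot[OF assms(1)] imp_eq_top[of bt bt] by simp
  then have "x \<cdot> y \<rightharpoonup> x \<cdot> z \<sqsubseteq> y \<rightharpoonup> z"
    using assms by (simp add: imp_eq_top top_le)
  moreover assume "x \<cdot> y \<sqsubseteq> x \<cdot> z"
  then have "x \<cdot> y \<rightharpoonup> x \<cdot> z = tp" using assms by (simp add: imp_eq_top)
  ultimately show "y \<sqsubseteq> z" using assms by (simp add: imp_eq_top top_le)
next
  assume "y \<sqsubseteq> z"
  then show "x \<cdot> y \<sqsubseteq> x \<cdot> z" using assms mul_mono2[of x x y z] by simp
qed

lemma mul_cancel:
  "\<lbrakk>x \<in> M; y \<in> C; z \<in> C\<rbrakk> \<Longrightarrow> x \<cdot> y = x \<cdot> z \<longleftrightarrow> y = z"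
  using mul_le_cancel[of x y z] mul_le_cancel[of x z y] le_antisym[of y z]
  by (metis DiffD1 closed(3) le_refl)

text \<open>There are no zero divisors: a product below bottom residuates to
  \<open>x \<sqsubseteq> y \<rightharpoonup> bt\<close>, and \<open>y \<rightharpoonup> bt\<close>
  is bottom.\<close>

lemma mul_M: "\<lbrakk>x \<in> M; y \<in> M\<rbrakk> \<Longrightarrow> x \<cdot> y \<in> M"
  using residuation[of x y bt] imp_bot[of y] le_bot[of x] by auto

lemma top_M: "tp \<in> M"
proof -
  have "cst A q \<sqsubseteq> bt" if "tp = bt" for q
    using le_top[of "cst A q"] that by simp
  then show ?thesis using nontrivial le_bot by auto
qed

lemma mul_bot [simp]: "x \<in> C \<Longrightarrow> x \<cdot> bt = bt" "x \<in> C \<Longrightarrow> bt \<cdot> x = bt"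
  using mul_le[of bt x] le_bot[of "bt \<cdot> x"] mul_comm[of bt x] by auto

section \<open>Order of the constants\<close>

lemma cst_mult: "cst A p \<cdot> cst A q = cst A (ur_mult p q)"
  and cst_imp: "cst A p \<rightharpoonup> cst A q = cst A (ur_imp p q)"
  and cst_zero: "cst A ur_zero = bt"
  and cst_one: "cst A ur_one = tp"
  using RPA by (auto simp: RPA_def)

text \<open>If some r < 1 had constant top, so would all its powers. Some power lies below the
  nontrivial \<open>q\<close>, and the implication law for constants then forces the constant of
  \<open>q\<close> to be top too. From here on all constants are distinct.\<close>

lemma cst_eq_top:
  assumes "cst A r = tp"
  shows "r = ur_one"
proof (rule ccontr)
  assume "r \<noteq> ur_one"
  then have r: "rat_of_unit r < 1"
    using rat_of_unit[of r] by (auto simp: ur_one.rep_eq order_less_le simp flip: rat_of_unit_inject)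
  obtain q where q: "0 < rat_of_unit q" "cst A q \<noteq> tp"
    using nontrivial by (auto simp: open_unit_rats_def)
  have "\<exists>s. rat_of_unit s = rat_of_unit r ^ k \<and> cst A s = tp" for k
  proof (induction k)
    case 0
    show ?case by (intro exI[of _ ur_one]) (simp add: ur_one.rep_eq cst_one)
  next
    case (Suc k)
    then obtain s where "rat_of_unit s = rat_of_unit r ^ k" "cst A s = tp" by blast
    then show ?case using cst_mult[of r s] assms
      by (intro exI[of _ "ur_mult r s"]) (auto simp: ur_mult.rep_eq)
  qed
  moreover obtain k where "rat_of_unit r ^ k < rat_of_unit q"
    using real_arch_pow_inv[of "of_rat (rat_of_unit q)" "of_rat (rat_of_unit r) :: real"] q(1) r
    by (auto simp: of_rat_less simp flip: of_rat_power)
  ultimately obtain s where "rat_of_unit s < rat_of_unit q" "cst A s = tp" by metis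
  then have "ur_imp s q = ur_one"
    by (simp add: ur_imp.rep_eq ur_one.rep_eq prod_imp_def flip: rat_of_unit_inject)
  then have "tp \<rightharpoonup> cst A q = tp"
    using cst_imp[of s q] \<open>cst A s = tp\<close> cst_one by simp
  then show False using q(2) imp_eq_top[of tp "cst A q"] top_le by simp
qed

lemma cst_le: "cst A p \<sqsubseteq> cst A q \<longleftrightarrow> rat_of_unit p \<le> rat_of_unit q"
proof -
  have "cst A p \<sqsubseteq> cst A q \<longleftrightarrow> cst A (ur_imp p q) = tp"
    by (simp add: imp_eq_top flip: cst_imp)
  also have "\<dots> \<longleftrightarrow> ur_imp p q = ur_one"
    using cst_eq_top cst_one by metis
  also have "\<dots> \<longleftrightarrow> rat_of_unit p \<le> rat_of_unit q"
    using rat_of_unit[of p] rat_of_unit[of q]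
    by (auto simp: ur_imp.rep_eq ur_one.rep_eq prod_imp_def simp flip: rat_of_unit_inject)
  finally show ?thesis .
qed

lemma cst_M: "0 < rat_of_unit q \<Longrightarrow> cst A q \<in> M"
  using cst_le[of q ur_zero] le_bot[of "cst A q"] by (auto simp: cst_zero ur_zero.rep_eq)

section \<open>Powers and roots\<close>

primrec pw :: "'a \<Rightarrow> nat \<Rightarrow> 'a" where
  "pw x 0 = tp"
| "pw x (Suc n) = x \<cdot> pw x n"

lemma eval_pow_term: "eval_term A v (pow_term t n) = pw (eval_term A v t) n"
  by (induction n) auto

lemma pw_closed [simp]: "x \<in> C \<Longrightarrow> pw x n \<in> C"
  by (induction n) auto

lemma pw_M: "x \<in> M \<Longrightarrow> pw x n \<in> M"
  by (induction n) (simp_all only: pw.simps top_M mul_M)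

lemma pw_mul: "\<lbrakk>x \<in> C; y \<in> C\<rbrakk> \<Longrightarrow> pw (x \<cdot> y) n = pw x n \<cdot> pw y n"
  by (induction n) (auto simp: mul_ac)

lemma pw_add: "x \<in> C \<Longrightarrow> pw x (m + n) = pw x m \<cdot> pw x n"
  by (induction m) (auto simp: mul_ac)

lemma pw_top [simp]: "pw tp n = tp"
  by (induction n) auto

lemma pw_pw: "x \<in> C \<Longrightarrow> pw (pw x m) n = pw x (n * m)"
  by (induction n) (auto simp: pw_add)

text \<open>The n-th root of the constant should be the fraction y / x. If
  \<open>y \<sqsubseteq> x\<close>, the residuum \<open>x \<rightharpoonup> y\<close> is this
  fraction. Otherwise cancellation makes the constant a divisor of top, hence equal to top, and top
  is its own root.\<close>

lemma root_of_quotient: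
  assumes "x \<in> M" "y \<in> M" and eq: "cst A q \<cdot> pw x n = pw y n"
  shows "\<exists>z\<in>C. pw z n = cst A q"
proof (cases "y \<sqsubseteq> x")
  case True
  then have "pw y n = pw x n \<cdot> pw (x \<rightharpoonup> y) n"
    using mul_imp[of y x] assms pw_mul[of x "x \<rightharpoonup> y" n] by simp
  then show ?thesis
    using mul_cancel[OF pw_M[OF assms(1)], of "cst A q" "pw (x \<rightharpoonup> y) n" n] assms
      mul_comm[of "cst A q" "pw x n"]
    by (intro bexI[of _ "x \<rightharpoonup> y"]) auto
next
  case False
  then have "x \<sqsubseteq> y" using linear assms by blast
  then have "pw x n = pw y n \<cdot> pw (y \<rightharpoonup> x) n"
    using mul_imp[of x y] assms pw_mul[of y "y \<rightharpoonup> x" n] by simp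
  then have "pw y n \<cdot> (cst A q \<cdot> pw (y \<rightharpoonup> x) n) = pw y n \<cdot> tp"
    using eq assms mul_left_comm[of "cst A q" "pw y n" "pw (y \<rightharpoonup> x) n"] by simp
  then have "cst A q \<cdot> pw (y \<rightharpoonup> x) n = tp"
    using mul_cancel[OF pw_M[OF assms(2)], of "cst A q \<cdot> pw (y \<rightharpoonup> x) n" tp n] assms by simp
  then have "cst A q = tp"
    using mul_le[of "cst A q" "pw (y \<rightharpoonup> x) n"] assms top_le by simp
  then show ?thesis by (intro bexI[of _ tp]) auto
qed

end

section \<open>Fractions of monomials\<close>

definition log_unit :: "unit_rat \<Rightarrow> real" where
  "log_unit q = ln (of_rat (rat_of_unit q))"

lemma log_unit_in: "0 < rat_of_unit q \<Longrightarrow> log_unit q \<in> log_rats"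
  unfolding log_unit_def by (intro log_ratsI) auto

lemma log_unit_inject:
  "\<lbrakk>0 < rat_of_unit p; 0 < rat_of_unit q\<rbrakk> \<Longrightarrow> log_unit p = log_unit q \<longleftrightarrow> p = q"
  by (simp add: log_unit_def rat_of_unit_inject)

lemma log_unit_le:
  "\<lbrakk>0 < rat_of_unit p; 0 < rat_of_unit q\<rbrakk> \<Longrightarrow> log_unit p \<le> log_unit q \<longleftrightarrow> rat_of_unit p \<le> rat_of_unit q"
  by (simp add: log_unit_def of_rat_less_eq)

lemma log_unit_mult:
  "\<lbrakk>0 < rat_of_unit p; 0 < rat_of_unit q\<rbrakk> \<Longrightarrow> log_unit (ur_mult p q) = log_unit p + log_unit q"
  by (simp add: log_unit_def ur_mult.rep_eq of_rat_mult ln_mult)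

lemma log_unit_one [simp]: "log_unit ur_one = 0"
  by (simp add: log_unit_def ur_one.rep_eq)

lemma ur_mult_pos:
  "\<lbrakk>0 < rat_of_unit p; 0 < rat_of_unit q\<rbrakk> \<Longrightarrow> 0 < rat_of_unit (ur_mult p q)"
  by (simp add: ur_mult.rep_eq)

lemma ur_one_pos [simp]: "0 < rat_of_unit ur_one"
  by (simp add: ur_one.rep_eq)

lemma log_rats_cases:
  assumes "l \<in> log_rats"
  obtains q where "0 < rat_of_unit q" "l = log_unit q \<or> - l = log_unit q"
proof -
  obtain x where x: "0 < x" "l = ln (of_rat x)"
    using assms by (auto simp: log_rats_def Rats_def)
  show ?thesis
  proof (cases "x \<le> 1")
    case True
    then show ?thesis
      using x that[of "Abs_unit_rat x"] by (simp add: log_unit_def Abs_unit_rat_inverse)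
  next
    case False
    then have "inverse x \<in> {q. 0 \<le> q \<and> q \<le> 1}" by (simp add: field_simps)
    then show ?thesis
      using x that[of "Abs_unit_rat (inverse x)"]
      by (simp add: log_unit_def Abs_unit_rat_inverse of_rat_inverse ln_inverse)
  qed
qed

locale generated_chain = product_chain A for A :: "'a rpa_struct" +
  fixes g :: "nat \<Rightarrow> 'a" and N :: nat
  assumes g_M: "g i \<in> carrier A - {bot_el A}"
begin

lemma g_C [simp]: "g i \<in> C" using g_M by blast

primrec gprod :: "(nat \<Rightarrow> nat) \<Rightarrow> nat \<Rightarrow> 'a" where
  "gprod b 0 = tp"
| "gprod b (Suc n) = gprod b n \<cdot> pw (g n) (b n)"

lemma gprod_M: "gprod b n \<in> M"
  by (induction n) (simp_all only: gprod.simps top_M mul_M pw_M g_M)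

lemma gprod_C [simp]: "gprod b n \<in> C" using gprod_M by blast

lemma gprod_add: "gprod (\<lambda>i. b i + d i) n = gprod b n \<cdot> gprod d n"
  by (induction n) (auto simp: pw_add mul_ac)

lemma gprod_mult: "gprod (\<lambda>i. k * b i) n = pw (gprod b n) k"
  by (induction n) (auto simp: pw_mul pw_pw)

lemma gprod_zero [simp]: "gprod (\<lambda>i. 0) n = tp"
  by (induction n) auto

lemma gprod_unit: "gprod (\<lambda>j. if j = i then 1 else 0) n = (if i < n then g i else tp)"
  by (induction n) (auto simp: less_Suc_eq)

definition mon :: "unit_rat \<Rightarrow> (nat \<Rightarrow> nat) \<Rightarrow> 'a" where
  "mon q b = cst A q \<cdot> gprod b N"

lemma mon_C [simp]: "mon q b \<in> C"
  by (simp add: mon_def)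

lemma mon_M: "0 < rat_of_unit q \<Longrightarrow> mon q b \<in> M"
  unfolding mon_def by (intro mul_M cst_M gprod_M)

lemma mon_mult: "mon (ur_mult p q) (\<lambda>i. b i + d i) = mon p b \<cdot> mon q d"
  by (simp add: mon_def gprod_add mul_ac flip: cst_mult)

text \<open>Coefficients above 1 and negative exponents have no meaning in \<open>A\<close>. The
  formal monomial given by \<open>l\<close> and \<open>a\<close> is therefore split into a numerator
  \<open>p\<close>, \<open>b\<close> and a denominator \<open>q\<close>, \<open>d\<close>, which
  both exist there.\<close>

definition is_frac :: "real \<Rightarrow> (nat \<Rightarrow> int) \<Rightarrow> unit_rat \<Rightarrow> (nat \<Rightarrow> nat) \<Rightarrow> unit_rat \<Rightarrow> (nat \<Rightarrow> nat) \<Rightarrow> bool" where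
  "is_frac l a p b q d \<longleftrightarrow> 0 < rat_of_unit p \<and> 0 < rat_of_unit q \<and>
     l = log_unit p - log_unit q \<and> a = (\<lambda>i. int (b i) - int (d i))"

definition frac_le :: "real \<Rightarrow> (nat \<Rightarrow> int) \<Rightarrow> bool" where
  "frac_le l a \<longleftrightarrow> (\<exists>p b q d. is_frac l a p b q d \<and> mon p b \<sqsubseteq> mon q d)"

lemma is_frac_mult:
  assumes "is_frac l a p b q d" "is_frac l' a' p' b' q' d'"
  shows "is_frac (l + l') (\<lambda>i. a i + a' i) (ur_mult p p') (\<lambda>i. b i + b' i) (ur_mult q q') (\<lambda>i. d i + d' i)"
  using assms by (auto simp: is_frac_def ur_mult_pos log_unit_mult)

lemma is_frac_inverse: "is_frac l a p b q d \<Longrightarrow> is_frac (- l) (\<lambda>i. - a i) q d p b"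
  by (auto simp: is_frac_def)

lemma cross_mult:
  assumes "is_frac l a p b q d" "is_frac l a p' b' q' d'"
  shows "mon p b \<cdot> mon q' d' = mon p' b' \<cdot> mon q d"
proof -
  have "log_unit (ur_mult p q') = log_unit (ur_mult p' q)"
    using assms by (auto simp: is_frac_def log_unit_mult)
  then have "ur_mult p q' = ur_mult p' q"
    using assms log_unit_inject by (auto simp: is_frac_def ur_mult_pos)
  moreover have "(\<lambda>i. b i + d' i) = (\<lambda>i. b' i + d i)"
  proof
    fix i
    have "int (b i) - int (d i) = int (b' i) - int (d' i)"
      using assms unfolding is_frac_def by metis
    then show "b i + d' i = b' i + d i" by linarith
  qed
  ultimately show ?thesis by (metis mon_mult)
qed

text \<open>The existential in \<open>frac_le\<close> does not depend on the chosen fraction: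
  multiply by the denominator of the other fraction, use \<open>cross_mult\<close>, and cancel that
  denominator, which is nonzero.\<close>

lemma frac_le_iff:
  assumes "is_frac l a p b q d"
  shows "frac_le l a \<longleftrightarrow> mon p b \<sqsubseteq> mon q d"
proof
  assume "frac_le l a"
  then obtain p' b' q' d' where fr: "is_frac l a p' b' q' d'" and le: "mon p' b' \<sqsubseteq> mon q' d'"
    by (auto simp: frac_le_def)
  have "mon q' d' \<cdot> mon p b = mon p' b' \<cdot> mon q d"
    using cross_mult[OF assms fr] mul_comm[of "mon p b" "mon q' d'"] by simp
  also have "\<dots> \<sqsubseteq> mon q' d' \<cdot> mon q d"
    using le by (intro mul_mono) auto
  finally show "mon p b \<sqsubseteq> mon q d"
    using mul_le_cancel[of "mon q' d'" "mon p b" "mon q d"] mon_M[of q' d'] fr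
    by (simp add: is_frac_def)
qed (use assms in \<open>auto simp: frac_le_def\<close>)

text \<open>The sign of \<open>l\<close> decides whether the constant goes into the numerator or the
  denominator. That the other coefficient is 1 is what the purity argument relies on.\<close>

lemma is_frac_exists:
  assumes "l \<in> log_rats"
  obtains p q where "is_frac l a p (\<lambda>i. nat (a i)) q (\<lambda>i. nat (- a i))" "p = ur_one \<or> q = ur_one"
proof -
  obtain q where q: "0 < rat_of_unit q" "l = log_unit q \<or> - l = log_unit q"
    using log_rats_cases[OF assms] .
  have "a = (\<lambda>i. int (nat (a i)) - int (nat (- a i)))" by auto
  then show ?thesis
    using q that[of q ur_one] that[of ur_one q] by (auto simp: is_frac_def)
qed

text \<open>States, without division, that \<open>u\<close> is the value of a fraction for
  \<open>l\<close> and \<open>a\<close>.\<close>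

definition represents :: "'a \<Rightarrow> real \<Rightarrow> (nat \<Rightarrow> int) \<Rightarrow> bool" where
  "represents u l a \<longleftrightarrow> u \<in> M \<and> (\<exists>p b q d. is_frac l a p b q d \<and> u \<cdot> mon q d = mon p b)"

lemma represents_M: "represents u l a \<Longrightarrow> u \<in> M"
  by (simp add: represents_def)

lemma represents_cst: "0 < rat_of_unit q \<Longrightarrow> represents (cst A q) (log_unit q) (\<lambda>i. 0)"
  unfolding represents_def using cst_M[of q]
  by (intro conjI exI[of _ q] exI[of _ "\<lambda>_. 0"] exI[of _ ur_one])
    (auto simp: is_frac_def mon_def cst_one)

lemma represents_top: "represents tp 0 (\<lambda>i. 0)"
  using represents_cst[of ur_one] by (simp add: cst_one)

lemma represents_generator:
  assumes "i < N"
  shows "represents (g i) 0 (\<lambda>j. if j = i then 1 else 0)"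
  unfolding represents_def using g_M assms
  by (intro conjI exI[of _ ur_one] exI[of _ "\<lambda>j. if j = i then 1 else 0"] exI[of _ "\<lambda>_. 0"])
    (auto simp: is_frac_def mon_def cst_one gprod_unit)

lemma represents_mult:
  assumes "represents u l a" "represents w m b"
  shows "represents (u \<cdot> w) (l + m) (\<lambda>i. a i + b i)"
proof -
  obtain p1 b1 q1 d1 p2 b2 q2 d2 where
    fr: "is_frac l a p1 b1 q1 d1" "is_frac m b p2 b2 q2 d2" and
    eq: "u \<cdot> mon q1 d1 = mon p1 b1" "w \<cdot> mon q2 d2 = mon p2 b2"
    using assms by (auto simp: represents_def)
  have uw: "u \<in> M" "w \<in> M" using assms by (auto simp: represents_def)
  have "u \<cdot> w \<cdot> (mon q1 d1 \<cdot> mon q2 d2) = (u \<cdot> mon q1 d1) \<cdot> (w \<cdot> mon q2 d2)"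
    using uw by (simp add: mul_ac)
  then have "u \<cdot> w \<cdot> mon (ur_mult q1 q2) (\<lambda>i. d1 i + d2 i) = mon (ur_mult p1 p2) (\<lambda>i. b1 i + b2 i)"
    by (simp add: eq mon_mult)
  with is_frac_mult[OF fr] mul_M[OF uw] show ?thesis
    unfolding represents_def by blast
qed

lemma represents_quotient:
  assumes "represents u l a" "represents w m b" "z \<in> C" "w \<cdot> z = u"
  shows "represents z (l - m) (\<lambda>i. a i - b i)"
proof -
  obtain p1 b1 q1 d1 p2 b2 q2 d2 where
    fr: "is_frac l a p1 b1 q1 d1" "is_frac m b p2 b2 q2 d2" and
    eq: "u \<cdot> mon q1 d1 = mon p1 b1" "w \<cdot> mon q2 d2 = mon p2 b2"
    using assms by (auto simp: represents_def)
  have uw: "u \<in> M" "w \<in> M" using assms by (auto simp: represents_def)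
  then have z: "z \<in> M" using assms(3,4) by auto
  have "z \<cdot> (mon q1 d1 \<cdot> mon p2 b2) = (w \<cdot> z) \<cdot> mon q1 d1 \<cdot> mon q2 d2"
    unfolding eq(2)[symmetric] using uw assms(3) by (simp add: mul_ac)
  also have "\<dots> = mon p1 b1 \<cdot> mon q2 d2"
    using eq(1) by (simp add: assms(4))
  finally have "z \<cdot> mon (ur_mult q1 p2) (\<lambda>i. d1 i + b2 i) = mon (ur_mult p1 q2) (\<lambda>i. b1 i + d2 i)"
    by (simp add: mon_mult)
  moreover have "is_frac (l - m) (\<lambda>i. a i - b i) (ur_mult p1 q2) (\<lambda>i. b1 i + d2 i)
      (ur_mult q1 p2) (\<lambda>i. d1 i + b2 i)"
    using is_frac_mult[OF fr(1) is_frac_inverse[OF fr(2)]] by simp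
  ultimately show ?thesis
    using z unfolding represents_def by blast
qed

text \<open>Multiplying both sides by the two denominators turns the comparison into one between
  numerator and denominator of the quotient fraction.\<close>

lemma represents_le:
  assumes "represents u l a" "represents w m b"
  shows "u \<sqsubseteq> w \<longleftrightarrow> frac_le (l - m) (\<lambda>i. a i - b i)"
proof -
  obtain p1 b1 q1 d1 p2 b2 q2 d2 where
    fr: "is_frac l a p1 b1 q1 d1" "is_frac m b p2 b2 q2 d2" and
    eq: "u \<cdot> mon q1 d1 = mon p1 b1" "w \<cdot> mon q2 d2 = mon p2 b2"
    using assms by (auto simp: represents_def)
  have uw: "u \<in> C" "w \<in> C" using assms by (auto simp: represents_def)
  have "mon q1 d1 \<cdot> mon q2 d2 \<in> M"
    using fr by (intro mul_M mon_M) (auto simp: is_frac_def)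
  from mul_le_cancel[OF this uw]
  have "u \<sqsubseteq> w \<longleftrightarrow> mon q1 d1 \<cdot> mon q2 d2 \<cdot> u \<sqsubseteq> mon q1 d1 \<cdot> mon q2 d2 \<cdot> w" by simp
  also have "mon q1 d1 \<cdot> mon q2 d2 \<cdot> u = mon p1 b1 \<cdot> mon q2 d2"
    unfolding eq(1)[symmetric] using uw by (simp add: mul_ac)
  also have "mon q1 d1 \<cdot> mon q2 d2 \<cdot> w = mon q1 d1 \<cdot> mon p2 b2"
    unfolding eq(2)[symmetric] using uw by (simp add: mul_ac)
  also have "mon p1 b1 \<cdot> mon q2 d2 \<sqsubseteq> mon q1 d1 \<cdot> mon p2 b2 \<longleftrightarrow> frac_le (l - m) (\<lambda>i. a i - b i)"
    using frac_le_iff[OF is_frac_mult[OF fr(1) is_frac_inverse[OF fr(2)]]]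
    by (simp add: mon_mult)
  finally show ?thesis .
qed

text \<open>Only \<open>P_pure\<close> draws on the root axioms: a relation between n-th powers
  produces an n-th root of a constant in \<open>A\<close>, hence a rational root. The remaining
  conditions come from monotonicity, linearity and the order of the constants.\<close>

lemma pure_cone_frac_le:
  assumes no_root: "\<And>p n z. \<lbrakk>n \<ge> 1; rat_of_unit p < 1; z \<in> C; pw z n = cst A p\<rbrakk>
    \<Longrightarrow> root n (of_rat (rat_of_unit p)) \<in> \<rat>"
  shows "pure_cone log_rats frac_le"
proof -
  interpret dense_subgroup log_rats by (rule dense_subgroup_log_rats)
  show ?thesis
  proof unfold_locales
    fix l a m b
    assume "frac_le l a" "frac_le m b"
    then obtain p1 b1 q1 d1 p2 b2 q2 d2 where
      fr: "is_frac l a p1 b1 q1 d1" "is_frac m b p2 b2 q2 d2" and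
      "mon p1 b1 \<sqsubseteq> mon q1 d1" "mon p2 b2 \<sqsubseteq> mon q2 d2"
      unfolding frac_le_def by blast
    then show "frac_le (l + m) (\<lambda>i. a i + b i)"
      unfolding frac_le_iff[OF is_frac_mult[OF fr]] mon_mult by (intro mul_mono2) auto
  next
    fix l a
    assume "l \<in> log_rats"
    then obtain p q where fr: "is_frac l a p (\<lambda>i. nat (a i)) q (\<lambda>i. nat (- a i))"
      using is_frac_exists by blast
    then show "frac_le l a \<or> frac_le (- l) (\<lambda>i. - a i)"
      unfolding frac_le_iff[OF fr] frac_le_iff[OF is_frac_inverse[OF fr]]
      by (intro linear) auto
  next
    fix l
    assume "l \<in> log_rats"
    then obtain p q where fr: "is_frac l (\<lambda>_. 0) p (\<lambda>_. 0) q (\<lambda>_. 0)"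
      using is_frac_exists[of l "\<lambda>_. 0"] unfolding minus_zero nat_0 by metis
    then show "frac_le l (\<lambda>i. 0) \<longleftrightarrow> l \<le> 0"
      unfolding frac_le_iff[OF fr] by (auto simp: mon_def cst_le is_frac_def simp flip: log_unit_le)
  next
    fix l a and n :: nat
    assume l: "l \<in> log_rats" and n: "n > 0"
      and le: "frac_le l (\<lambda>i. int n * a i)" "frac_le (- l) (\<lambda>i. - (int n * a i))"
    have root: "log_unit q / n \<in> log_rats"
      if q: "0 < rat_of_unit q" and xy: "x \<in> M" "y \<in> M" "cst A q \<cdot> pw x n = pw y n" for q x y
    proof -
      obtain z where z: "z \<in> C" "pw z n = cst A q"
        using root_of_quotient[OF xy] by blast
      \<comment> \<open>The assumption \<open>no_root\<close> does not speak of the rational 1,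
        whose root is 1 anyway.\<close>
      have "root n (of_rat (rat_of_unit q)) \<in> \<rat>"
        using no_root[of n q z] z n rat_of_unit[of q] by (cases "rat_of_unit q = 1") auto
      then have "ln (root n (of_rat (rat_of_unit q))) \<in> log_rats"
        using q n by (intro log_ratsI) auto
      then show ?thesis using q n by (simp add: log_unit_def ln_root)
    qed
    \<comment> \<open>With one coefficient equal to 1, equality of numerator and denominator becomes
      an equation with a single constant, as \<open>root\<close> requires.\<close>
    obtain p q where fr: "is_frac l (\<lambda>i. int n * a i) p (\<lambda>i. nat (int n * a i)) q (\<lambda>i. nat (- (int n * a i)))"
      and one: "p = ur_one \<or> q = ur_one"
      using is_frac_exists[OF l] by blast
    define x where "x = gprod (\<lambda>i. nat (a i)) N"
    define y where "y = gprod (\<lambda>i. nat (- a i)) N"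
    have xy: "x \<in> M" "y \<in> M" unfolding x_def y_def by (rule gprod_M)+
    have "(\<lambda>i. nat (int n * a i)) = (\<lambda>i. n * nat (a i))"
      "(\<lambda>i. nat (- (int n * a i))) = (\<lambda>i. n * nat (- a i))"
      by (auto simp: nat_mult_distrib simp flip: mult_minus_right)
    then have "mon p (\<lambda>i. nat (int n * a i)) = cst A p \<cdot> pw x n"
      "mon q (\<lambda>i. nat (- (int n * a i))) = cst A q \<cdot> pw y n"
      by (simp_all add: mon_def x_def y_def gprod_mult)
    moreover have "mon p (\<lambda>i. nat (int n * a i)) = mon q (\<lambda>i. nat (- (int n * a i)))"
      using le unfolding frac_le_iff[OF fr] frac_le_iff[OF is_frac_inverse[OF fr]]
      by (rule le_antisym) auto
    ultimately have eq: "cst A p \<cdot> pw x n = cst A q \<cdot> pw y n" by simp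
    from one show "l / n \<in> log_rats"
    proof
      assume "p = ur_one"
      then have "log_unit q / n \<in> log_rats"
        using root[of q y x] xy eq fr by (auto simp: cst_one is_frac_def)
      then have "- (log_unit q / n) \<in> log_rats" by (rule minus)
      then show ?thesis using fr \<open>p = ur_one\<close> by (simp add: is_frac_def)
    next
      assume "q = ur_one"
      then have "log_unit p / n \<in> log_rats"
        using root[of p x y] xy eq fr by (auto simp: cst_one is_frac_def)
      then show ?thesis using fr \<open>q = ur_one\<close> by (simp add: is_frac_def)
    qed
  qed
qed

end

section \<open>Normal forms of terms\<close>

text \<open>Normal forms of terms: \<open>None\<close> is the bottom element, and \<open>Some (l, a)\<close> is the monomial
  with coefficient \<open>exp l\<close> and exponents \<open>a\<close>. The comparison \<open>P\<close> decides which monomials are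
  at most \<open>1\<close>, and \<open>Z\<close> which variables are zero.\<close>

type_synonym monomial = "(real \<times> (nat \<Rightarrow> int)) option"

fun monom_le :: "(real \<Rightarrow> (nat \<Rightarrow> int) \<Rightarrow> bool) \<Rightarrow> monomial \<Rightarrow> monomial \<Rightarrow> bool" where
  "monom_le P None y \<longleftrightarrow> True"
| "monom_le P (Some (l, a)) None \<longleftrightarrow> False"
| "monom_le P (Some (l, a)) (Some (m, b)) \<longleftrightarrow> P (l - m) (\<lambda>i. a i - b i)"

fun monom_mult :: "monomial \<Rightarrow> monomial \<Rightarrow> monomial" where
  "monom_mult (Some (l, a)) (Some (m, b)) = Some (l + m, \<lambda>i. a i + b i)"
| "monom_mult _ _ = None"

text \<open>\<open>nf\<close> divides only when the divisor is not below the dividend, so never by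
  \<open>None\<close>. Returning \<open>None\<close> in that case agrees with real division by 0,
  which keeps \<open>eval_monom_div\<close> unconditional.\<close>

fun monom_div :: "monomial \<Rightarrow> monomial \<Rightarrow> monomial" where
  "monom_div (Some (l, a)) (Some (m, b)) = Some (l - m, \<lambda>i. a i - b i)"
| "monom_div _ _ = None"

definition monom_one :: monomial where
  "monom_one = Some (0, \<lambda>i. 0)"

primrec nf :: "(nat \<Rightarrow> bool) \<Rightarrow> (real \<Rightarrow> (nat \<Rightarrow> int) \<Rightarrow> bool) \<Rightarrow> rpa_term \<Rightarrow> monomial" where
  "nf Z P (Var i) = (if Z i then None else Some (0, \<lambda>j. if j = i then 1 else 0))"
| "nf Z P (Meet s t) = (if monom_le P (nf Z P s) (nf Z P t) then nf Z P s else nf Z P t)"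
| "nf Z P (Join s t) = (if monom_le P (nf Z P s) (nf Z P t) then nf Z P t else nf Z P s)"
| "nf Z P (Mult s t) = monom_mult (nf Z P s) (nf Z P t)"
| "nf Z P (Resid s t) =
    (if monom_le P (nf Z P s) (nf Z P t) then monom_one else monom_div (nf Z P t) (nf Z P s))"
| "nf Z P Zero = None"
| "nf Z P One = monom_one"
| "nf Z P (Cst q) = (if rat_of_unit q = 0 then None else Some (log_unit q, \<lambda>i. 0))"

text \<open>Equality is tested by two comparisons, not by identity of normal forms: distinct formal
  monomials have the same value when the generators satisfy a relation. The clause for
  \<open>Forall\<close> is a default value.\<close>

primrec nf_sat :: "(nat \<Rightarrow> bool) \<Rightarrow> (real \<Rightarrow> (nat \<Rightarrow> int) \<Rightarrow> bool) \<Rightarrow> fmla \<Rightarrow> bool" where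
  "nf_sat Z P (Eq s t) \<longleftrightarrow> monom_le P (nf Z P s) (nf Z P t) \<and> monom_le P (nf Z P t) (nf Z P s)"
| "nf_sat Z P (Neg \<phi>) \<longleftrightarrow> \<not> nf_sat Z P \<phi>"
| "nf_sat Z P (Conj \<phi> \<psi>) \<longleftrightarrow> nf_sat Z P \<phi> \<and> nf_sat Z P \<psi>"
| "nf_sat Z P (Disj \<phi> \<psi>) \<longleftrightarrow> nf_sat Z P \<phi> \<or> nf_sat Z P \<psi>"
| "nf_sat Z P (Forall i \<phi>) \<longleftrightarrow> False"

text \<open>The finitely many comparisons on which the normal form of a term, respectively the truth of
  a quantifier-free formula, depends.\<close>

fun monom_tests :: "monomial \<Rightarrow> monomial \<Rightarrow> (real \<times> (nat \<Rightarrow> int)) set" where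
  "monom_tests (Some (l, a)) (Some (m, b)) = {(l - m, \<lambda>i. a i - b i)}"
| "monom_tests _ _ = {}"

primrec tests :: "(nat \<Rightarrow> bool) \<Rightarrow> (real \<Rightarrow> (nat \<Rightarrow> int) \<Rightarrow> bool) \<Rightarrow> rpa_term \<Rightarrow>
    (real \<times> (nat \<Rightarrow> int)) set" where
  "tests Z P (Var i) = {}"
| "tests Z P (Meet s t) = tests Z P s \<union> tests Z P t \<union> monom_tests (nf Z P s) (nf Z P t)"
| "tests Z P (Join s t) = tests Z P s \<union> tests Z P t \<union> monom_tests (nf Z P s) (nf Z P t)"
| "tests Z P (Mult s t) = tests Z P s \<union> tests Z P t"
| "tests Z P (Resid s t) = tests Z P s \<union> tests Z P t \<union> monom_tests (nf Z P s) (nf Z P t)"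
| "tests Z P Zero = {}"
| "tests Z P One = {}"
| "tests Z P (Cst q) = {}"

primrec sat_tests :: "(nat \<Rightarrow> bool) \<Rightarrow> (real \<Rightarrow> (nat \<Rightarrow> int) \<Rightarrow> bool) \<Rightarrow> fmla \<Rightarrow>
    (real \<times> (nat \<Rightarrow> int)) set" where
  "sat_tests Z P (Eq s t) = tests Z P s \<union> tests Z P t \<union>
    monom_tests (nf Z P s) (nf Z P t) \<union> monom_tests (nf Z P t) (nf Z P s)"
| "sat_tests Z P (Neg \<phi>) = sat_tests Z P \<phi>"
| "sat_tests Z P (Conj \<phi> \<psi>) = sat_tests Z P \<phi> \<union> sat_tests Z P \<psi>"
| "sat_tests Z P (Disj \<phi> \<psi>) = sat_tests Z P \<phi> \<union> sat_tests Z P \<psi>"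
| "sat_tests Z P (Forall i \<phi>) = {}"

section \<open>Dependence on finitely many comparisons\<close>

lemma monom_le_cong:
  "(\<And>l a. (l, a) \<in> monom_tests x y \<Longrightarrow> P l a = Q l a) \<Longrightarrow> monom_le P x y = monom_le Q x y"
  by (cases "(P, x, y)" rule: monom_le.cases) auto

text \<open>The tests are those met when evaluating with \<open>P\<close>. Agreement on them sends
  the evaluation with \<open>Q\<close> through the same branches, so the tests of \<open>Q\<close>
  need no separate mention.\<close>

lemma nf_cong:
  "(\<And>l a. (l, a) \<in> tests Z P t \<Longrightarrow> P l a = Q l a) \<Longrightarrow> nf Z P t = nf Z Q t"
proof (induction t)
  case (Meet s t)
  have "monom_le P (nf Z P s) (nf Z P t) = monom_le Q (nf Z P s) (nf Z P t)"
    by (intro monom_le_cong Meet.prems; simp)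
  moreover have "nf Z P s = nf Z Q s" "nf Z P t = nf Z Q t"
    by (intro Meet.IH Meet.prems; simp)+
  ultimately show ?case by simp
next
  case (Join s t)
  have "monom_le P (nf Z P s) (nf Z P t) = monom_le Q (nf Z P s) (nf Z P t)"
    by (intro monom_le_cong Join.prems; simp)
  moreover have "nf Z P s = nf Z Q s" "nf Z P t = nf Z Q t"
    by (intro Join.IH Join.prems; simp)+
  ultimately show ?case by simp
next
  case (Resid s t)
  have "monom_le P (nf Z P s) (nf Z P t) = monom_le Q (nf Z P s) (nf Z P t)"
    by (intro monom_le_cong Resid.prems; simp)
  moreover have "nf Z P s = nf Z Q s" "nf Z P t = nf Z Q t"
    by (intro Resid.IH Resid.prems; simp)+
  ultimately show ?case by simp
qed auto

lemma nf_sat_cong: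
  "(\<And>l a. (l, a) \<in> sat_tests Z P \<phi> \<Longrightarrow> P l a = Q l a) \<Longrightarrow> nf_sat Z P \<phi> = nf_sat Z Q \<phi>"
proof (induction \<phi>)
  case (Eq s t)
  have "nf Z P s = nf Z Q s" "nf Z P t = nf Z Q t"
    by (intro nf_cong Eq; simp)+
  moreover have "monom_le P (nf Z P s) (nf Z P t) = monom_le Q (nf Z P s) (nf Z P t)"
    "monom_le P (nf Z P t) (nf Z P s) = monom_le Q (nf Z P t) (nf Z P s)"
    by (intro monom_le_cong Eq; simp)+
  ultimately show ?case by simp
qed auto

lemma finite_monom_tests: "finite (monom_tests x y)"
  by (cases "(x, y)" rule: monom_tests.cases) auto

lemma finite_tests: "finite (tests Z P t)"
  by (induction t) (auto simp: finite_monom_tests)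

lemma finite_sat_tests: "finite (sat_tests Z P \<phi>)"
  by (induction \<phi>) (auto simp: finite_monom_tests finite_tests)

text \<open>The forms that \<open>cone_solvable\<close> admits for \<open>log_rats\<close> and the
  generators below \<open>N\<close>.\<close>

definition monom_set :: "nat \<Rightarrow> (real \<times> (nat \<Rightarrow> int)) set" where
  "monom_set N = {(l, a). l \<in> log_rats \<and> (\<forall>i\<ge>N. a i = 0)}"

interpretation log_rats: dense_subgroup log_rats
  by (rule dense_subgroup_log_rats)

lemma set_option_nf:
  "term_vars t \<subseteq> {..<N} \<Longrightarrow> set_option (nf Z P t) \<subseteq> monom_set N"
proof (induction t)
  case (Mult s t)
  then show ?case
    by (cases "(nf Z P s, nf Z P t)" rule: monom_mult.cases) (auto simp: monom_set_def log_rats.add)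
next
  case (Resid s t)
  then show ?case
    by (cases "(nf Z P t, nf Z P s)" rule: monom_div.cases)
      (auto simp: monom_set_def log_rats.diff log_rats.zero monom_one_def)
next
  case (Cst q)
  then show ?case using rat_of_unit[of q] log_unit_in[of q] by (auto simp: monom_set_def)
qed (auto simp: monom_set_def log_rats.zero monom_one_def)

lemma monom_tests_subset:
  "\<lbrakk>set_option x \<subseteq> monom_set N; set_option y \<subseteq> monom_set N\<rbrakk> \<Longrightarrow> monom_tests x y \<subseteq> monom_set N"
  by (cases "(x, y)" rule: monom_tests.cases) (auto simp: monom_set_def log_rats.diff)

lemma tests_subset: "term_vars t \<subseteq> {..<N} \<Longrightarrow> tests Z P t \<subseteq> monom_set N"
  by (induction t) (simp_all add: monom_tests_subset set_option_nf)

lemma sat_tests_subset: "\<lbrakk>quantifier_free \<phi>; free_vars \<phi> \<subseteq> {..<N}\<rbrakk> \<Longrightarrow> sat_tests Z P \<phi> \<subseteq> monom_set N"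
  by (induction \<phi>) (simp_all add: monom_tests_subset set_option_nf tests_subset)

section \<open>Normal forms in a generated chain\<close>

context generated_chain
begin

definition represents_monom :: "'a \<Rightarrow> monomial \<Rightarrow> bool" where
  "represents_monom u x = (case x of None \<Rightarrow> u = bt | Some (l, a) \<Rightarrow> represents u l a)"

lemma represents_monom_C: "represents_monom u x \<Longrightarrow> u \<in> C"
  using represents_M[of u] by (auto simp: represents_monom_def split: option.splits)

lemma represents_monom_le:
  assumes "represents_monom u x" "represents_monom w y"
  shows "u \<sqsubseteq> w \<longleftrightarrow> monom_le frac_le x y"
  using assms represents_le[of u _ _ w] represents_M[of u] le_bot[of u] represents_monom_C[OF assms(2)]
  by (cases "(frac_le, x, y)" rule: monom_le.cases) (auto simp: represents_monom_def)

lemma represents_monom_mult: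
  assumes "represents_monom u x" "represents_monom w y"
  shows "represents_monom (u \<cdot> w) (monom_mult x y)"
  using assms represents_mult[of u _ _ w] represents_monom_C[OF assms(1)] represents_monom_C[OF assms(2)]
  by (cases "(x, y)" rule: monom_mult.cases) (auto simp: represents_monom_def)

lemma represents_monom_imp:
  assumes "represents_monom u x" "represents_monom w y"
  shows "represents_monom (u \<rightharpoonup> w) (if monom_le frac_le x y then monom_one else monom_div y x)"
proof (cases "u \<sqsubseteq> w")
  case True
  then show ?thesis
    using represents_monom_le[OF assms] assms[THEN represents_monom_C] represents_top
    by (simp add: imp_eq_top[THEN iffD2] represents_monom_def monom_one_def)
next
  case False
  have C: "u \<in> C" "w \<in> C" using assms[THEN represents_monom_C] .
  then have "w \<sqsubseteq> u" using False linear by blast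
  then have "u \<cdot> (u \<rightharpoonup> w) = w" using C by (rule mul_imp)
  moreover have "u \<in> M" using False C by auto
  ultimately have "represents_monom (u \<rightharpoonup> w) (monom_div y x)"
    using assms imp_bot[of u] represents_quotient[of w _ _ u _ _ "u \<rightharpoonup> w"] C
    by (cases "(y, x)" rule: monom_div.cases) (auto simp: represents_monom_def)
  then show ?thesis using represents_monom_le[OF assms] False by simp
qed

text \<open>The generators must agree with \<open>v\<close> only where \<open>v\<close> is not
  bottom; the other variables have normal form \<open>None\<close>.\<close>

lemma represents_eval:
  assumes "\<And>i. v i \<in> C" "\<And>i. v i \<noteq> bt \<Longrightarrow> g i = v i"
  shows "term_vars t \<subseteq> {..<N} \<Longrightarrow>
    represents_monom (eval_term A v t) (nf (\<lambda>i. v i = bt) frac_le t)"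
proof (induction t)
  case (Var i)
  then show ?case using represents_generator[of i] assms(2)[of i] by (auto simp: represents_monom_def)
next
  case (Meet s t)
  then show ?case using represents_monom_C
    by (auto simp: meet_eq represents_monom_le)
next
  case (Join s t)
  then show ?case using represents_monom_C
    by (auto simp: join_eq represents_monom_le)
next
  case (Cst q)
  have "q = ur_zero" if "rat_of_unit q = 0"
    using that by (simp add: ur_zero.rep_eq flip: rat_of_unit_inject)
  then show ?case using represents_cst[of q] rat_of_unit[of q] cst_zero
    by (auto simp: represents_monom_def)
next
  case (Mult s t)
  then show ?case by (simp add: represents_monom_mult)
next
  case (Resid s t)
  then show ?case using represents_monom_imp by simp
qed (use represents_top in \<open>auto simp: represents_monom_def monom_one_def\<close>)

lemma nf_sat_iff:
  assumes "\<And>i. v i \<in> C" "\<And>i. v i \<noteq> bt \<Longrightarrow> g i = v i"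
  shows "\<lbrakk>quantifier_free \<phi>; free_vars \<phi> \<subseteq> {..<N}\<rbrakk> \<Longrightarrow>
    sat A v \<phi> \<longleftrightarrow> nf_sat (\<lambda>i. v i = bt) frac_le \<phi>"
proof (induction \<phi>)
  case (Eq s t)
  then have rep: "represents_monom (eval_term A v s) (nf (\<lambda>i. v i = bt) frac_le s)"
    "represents_monom (eval_term A v t) (nf (\<lambda>i. v i = bt) frac_le t)"
    using represents_eval[OF assms] by auto
  have "eval_term A v s = eval_term A v t \<longleftrightarrow>
      eval_term A v s \<sqsubseteq> eval_term A v t \<and> eval_term A v t \<sqsubseteq> eval_term A v s"
    using rep[THEN represents_monom_C] le_antisym by auto
  then show ?case
    by (simp add: represents_monom_le[OF rep] represents_monom_le[OF rep(2,1)])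
qed auto

end

section \<open>Normal forms at a point of the unit cube\<close>

definition eval_le :: "nat \<Rightarrow> (nat \<Rightarrow> real) \<Rightarrow> real \<Rightarrow> (nat \<Rightarrow> int) \<Rightarrow> bool" where
  "eval_le N y l a \<longleftrightarrow> l + (\<Sum>i<N. of_int (a i) * y i) \<le> 0"

definition eval_monom :: "nat \<Rightarrow> (nat \<Rightarrow> real) \<Rightarrow> monomial \<Rightarrow> real" where
  "eval_monom N y x = (case x of None \<Rightarrow> 0 | Some (l, a) \<Rightarrow> exp (l + (\<Sum>i<N. of_int (a i) * y i)))"

lemma monom_le_eval: "monom_le (eval_le N y) x x' \<longleftrightarrow> eval_monom N y x \<le> eval_monom N y x'"
  by (cases "(eval_le N y, x, x')" rule: monom_le.cases)
    (auto simp: eval_le_def eval_monom_def sum_subtractf left_diff_distrib not_le split: option.splits)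

lemma eval_monom_mult: "eval_monom N y (monom_mult x x') = eval_monom N y x * eval_monom N y x'"
  by (cases "(x, x')" rule: monom_mult.cases)
    (simp_all add: eval_monom_def sum.distrib distrib_right exp_add)

lemma eval_monom_div:
  "eval_monom N y (monom_div x x') = eval_monom N y x / eval_monom N y x'"
  by (cases "(x, x')" rule: monom_div.cases)
    (simp_all add: eval_monom_def sum_subtractf left_diff_distrib exp_add exp_diff)

lemma eval_monom_one [simp]: "eval_monom N y monom_one = 1"
  by (simp add: eval_monom_def monom_one_def)

lemma sum_unit:
  fixes y :: "nat \<Rightarrow> real"
  assumes "i < N"
  shows "(\<Sum>j<N. of_int (if j = i then 1 else 0) * y j) = y i"
proof -
  have "(\<Sum>j<N. of_int (if j = i then 1 else 0) * y j) = (\<Sum>j<N. if j = i then y j else 0)"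
    by (intro sum.cong) auto
  then show ?thesis using assms by simp
qed

text \<open>Since exp is increasing, \<open>eval_le\<close> decides the real order of the monomials.
  So the same normal form procedure, run with \<open>eval_le\<close> for \<open>frac_le\<close>,
  computes the operations of \<open>Q_Pi\<close>.\<close>

lemma eval_Q_Pi:
  assumes "\<And>i. i < N \<Longrightarrow> w i = (if Z i then 0 else exp (y i))"
  shows "term_vars t \<subseteq> {..<N} \<Longrightarrow> eval_term Q_Pi w t = eval_monom N y (nf Z (eval_le N y) t)"
proof (induction t)
  case (Var i)
  then show ?case using assms[of i] by (auto simp: eval_monom_def sum_unit)
next
  case (Cst q)
  have "0 \<le> rat_of_unit q" using rat_of_unit[of q] by simp
  then show ?case by (auto simp: Q_Pi_def eval_monom_def log_unit_def)
qed (auto simp: Q_Pi_def monom_le_eval eval_monom_mult eval_monom_div prod_imp_def,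
    simp add: eval_monom_def)

lemma nf_sat_Q_Pi:
  assumes "\<And>i. i < N \<Longrightarrow> w i = (if Z i then 0 else exp (y i))"
  shows "\<lbrakk>quantifier_free \<phi>; free_vars \<phi> \<subseteq> {..<N}\<rbrakk> \<Longrightarrow> sat Q_Pi w \<phi> \<longleftrightarrow> nf_sat Z (eval_le N y) \<phi>"
  by (induction \<phi>) (auto simp: eval_Q_Pi[OF assms] monom_le_eval)

lemma finite_free_vars: "finite (free_vars \<phi>)"
proof -
  have "finite (term_vars t)" for t by (induction t) auto
  then show ?thesis by (induction \<phi>) auto
qed

text \<open>The truth value is transported, not only truth, so a counterexample in \<open>A\<close>
  yields one in \<open>Q_Pi\<close>.\<close>

lemma (in product_chain) sat_in_Q_Pi:
  assumes no_root: "\<And>p n z. \<lbrakk>n \<ge> 1; rat_of_unit p < 1; z \<in> C; pw z n = cst A p\<rbrakk>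
      \<Longrightarrow> root n (of_rat (rat_of_unit p)) \<in> \<rat>"
    and v: "\<And>i. v i \<in> C" and qf: "quantifier_free \<phi>"
  obtains w where "\<And>i. w i \<in> carrier Q_Pi" "sat Q_Pi w \<phi> \<longleftrightarrow> sat A v \<phi>"
proof -
  obtain N where N: "free_vars \<phi> \<subseteq> {..<N}"
    using finite_free_vars[of \<phi>] by (auto simp: finite_nat_set_iff_bounded)
  define Z where "Z i \<longleftrightarrow> v i = bt" for i
  \<comment> \<open>Bottom cannot be a generator; top is put in its place, and \<open>Z\<close>
    keeps track of the variables concerned.\<close>
  define g where "g i = (if Z i then tp else v i)" for i
  interpret generated_chain A g N
    by unfold_locales (use v top_M in \<open>auto simp: g_def Z_def\<close>)
  \<comment> \<open>The extra tests compare the generators with top. They hold in \<open>A\<close>,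
    and preserving them puts the solution below 1.\<close>
  define T where "T = sat_tests Z frac_le \<phi> \<union> (\<lambda>i. (0, \<lambda>j. if j = i then 1 else 0)) ` {..<N}"
  have fin: "finite T" unfolding T_def by (simp add: finite_sat_tests)
  have sub: "T \<subseteq> monom_set N"
    unfolding T_def using sat_tests_subset[OF qf N]
    by (auto simp: log_rats.zero monom_set_def)
  obtain y where y: "\<And>i. y i \<in> log_rats"
    and sol: "\<And>l a. (l, a) \<in> T \<Longrightarrow> frac_le l a \<longleftrightarrow> eval_le N y l a"
  proof (rule cone_solvableE[OF pure_cone_solvable[OF _ pure_cone_frac_le[OF no_root]] fin])
    show "l \<in> log_rats" if "(l, a) \<in> T" for l a
      using that sub by (auto simp: monom_set_def)
    show "a i = 0" if "(l, a) \<in> T" "i \<notin> {..<N}" for l a i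
      using that sub by (auto simp: monom_set_def)
  qed (auto simp: eval_le_def)
  \<comment> \<open>Variables from \<open>N\<close> on do not occur in the formula; the value 0
    keeps them in the carrier.\<close>
  define w where "w i = (if Z i \<or> N \<le> i then 0 else exp (y i))" for i
  have "exp (y i) \<le> 1" if "i < N" for i
  proof -
    have "frac_le 0 (\<lambda>j. if j = i then 1 else 0)"
      using represents_le[OF represents_generator[OF that] represents_top] by simp
    then have "eval_le N y 0 (\<lambda>j. if j = i then 1 else 0)"
      using that sol by (simp add: T_def)
    then show ?thesis
      using that by (simp add: eval_le_def sum_unit)
  qed
  then have "w i \<in> carrier Q_Pi" for i
    using y exp_log_rats by (auto simp: w_def Q_Pi_def)
  moreover have "sat Q_Pi w \<phi> \<longleftrightarrow> nf_sat Z (eval_le N y) \<phi>"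
    by (rule nf_sat_Q_Pi[OF _ qf N]) (simp add: w_def)
  moreover have "nf_sat Z frac_le \<phi> \<longleftrightarrow> nf_sat Z (eval_le N y) \<phi>"
    using sol by (intro nf_sat_cong) (auto simp: T_def)
  moreover have "sat A v \<phi> \<longleftrightarrow> nf_sat Z frac_le \<phi>"
    using nf_sat_iff[OF v _ qf N] by (simp add: g_def Z_def[abs_def])
  ultimately show ?thesis using that by blast
qed

section \<open>Universal theories\<close>

lemma holds_in_Forall: "holds_in A (Forall i \<phi>) \<longleftrightarrow> holds_in A \<phi>"
proof
  assume all: "holds_in A (Forall i \<phi>)"
  show "holds_in A \<phi>"
    unfolding holds_in_def
  proof (intro allI impI)
    fix v :: "nat \<Rightarrow> 'a"
    assume "\<forall>i. v i \<in> carrier A"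
    then have "sat A (v(i := v i)) \<phi>"
      using all unfolding holds_in_def sat.simps by blast
    then show "sat A v \<phi>" by simp
  qed
qed (auto simp: holds_in_def)

lemma universal_fmla_prefix:
  "universal_fmla \<phi> \<Longrightarrow> \<exists>is \<psi>. quantifier_free \<psi> \<and> \<phi> = foldr Forall is \<psi>"
proof (induction rule: universal_fmla.induct)
  case (1 \<phi>)
  then show ?case by (intro exI[of _ "[]"]) auto
next
  case (2 \<phi> i)
  then obtain js \<psi> where "quantifier_free \<psi>" "\<phi> = foldr Forall js \<psi>" by blast
  then show ?case by (intro exI[of _ "i # js"]) auto
qed

lemma holds_in_prefix: "holds_in A (foldr Forall is \<psi>) \<longleftrightarrow> holds_in A \<psi>"
  by (induction "is") (auto simp: holds_in_Forall)

lemma universal_closure: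
  assumes "quantifier_free \<psi>"
  obtains "is" where "universal_sentence (foldr Forall is \<psi>)"
proof -
  obtain js where js: "set js = free_vars \<psi>"
    using finite_list[OF finite_free_vars] by blast
  have "universal_fmla (foldr Forall js' \<psi>)" "free_vars (foldr Forall js' \<psi>) = free_vars \<psi> - set js'" for js'
    by (induction js') (auto intro: universal_fmla.intros assms)
  with js that show ?thesis by (metis Diff_cancel universal_sentence_def)
qed

text \<open>With prefixes irrelevant for validity, both inclusions can be proved for open
  quantifier-free formulas, to which \<open>sat_in_Q_Pi\<close> and \<open>transfer\<close>
  apply.\<close>

lemma Mod_universal_theory_iff:
  "A \<in> Mod (universal_theory B) \<longleftrightarrow>
    rpa_structure A \<and> (\<forall>\<psi>. quantifier_free \<psi> \<longrightarrow> holds_in B \<psi> \<longrightarrow> holds_in A \<psi>)"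
proof
  assume A: "A \<in> Mod (universal_theory B)"
  have "holds_in A \<psi>" if qf: "quantifier_free \<psi>" and holds: "holds_in B \<psi>" for \<psi>
  proof -
    obtain js where "universal_sentence (foldr Forall js \<psi>)"
      using universal_closure[OF qf] .
    then show ?thesis
      using A holds by (simp add: Mod_def universal_theory_def flip: holds_in_prefix[of _ js \<psi>])
  qed
  then show "rpa_structure A \<and> (\<forall>\<psi>. quantifier_free \<psi> \<longrightarrow> holds_in B \<psi> \<longrightarrow> holds_in A \<psi>)"
    using A by (auto simp: Mod_def)
next
  assume A: "rpa_structure A \<and> (\<forall>\<psi>. quantifier_free \<psi> \<longrightarrow> holds_in B \<psi> \<longrightarrow> holds_in A \<psi>)"
  have "holds_in A \<phi>" if \<phi>: "universal_sentence \<phi>" "holds_in B \<phi>" for \<phi>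
  proof -
    obtain js \<psi> where "quantifier_free \<psi>" "\<phi> = foldr Forall js \<psi>"
      using \<phi>(1) universal_fmla_prefix[of \<phi>] unfolding universal_sentence_def by blast
    then show ?thesis using \<phi>(2) A by (simp add: holds_in_prefix)
  qed
  with A show "A \<in> Mod (universal_theory B)" by (auto simp: Mod_def universal_theory_def)
qed

text \<open>The axioms supply exactly the assumptions of \<open>sat_in_Q_Pi\<close>. One element of
  \<open>S\<close> gives nontriviality, which is why any nonempty \<open>S\<close> will do.\<close>

lemma model_in_Mod_universal_theory:
  fixes A :: "'a rpa_struct"
  assumes "A \<in> RPA" "A \<in> Mod (QPi_axioms S)" "S \<noteq> {}" "S \<subseteq> open_unit_rats"
  shows "A \<in> Mod (universal_theory Q_Pi)"
proof -
  have ax: "holds_in A \<phi>" if "\<phi> \<in> QPi_axioms S" for \<phi>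
    using assms(2) that by (simp add: Mod_def)
  have str: "rpa_structure A" using assms(2) by (simp add: Mod_def)
  then have top: "top_el A \<in> carrier A" by (simp add: rpa_structure_def bl_structure_def)
  interpret product_chain A
  proof
    show "A \<in> RPA" by fact
    show "bl_le A x y \<or> bl_le A y x" if "x \<in> carrier A" "y \<in> carrier A" for x y
    proof -
      have "holds_in A (Disj (le_fmla (Var 0) (Var 1)) (le_fmla (Var 1) (Var 0)))"
        using ax[of linearity_axiom] by (simp add: QPi_axioms_def linearity_axiom_def holds_in_Forall)
      then have "sat A (\<lambda>i. if i = 0 then x else y) (Disj (le_fmla (Var 0) (Var 1)) (le_fmla (Var 1) (Var 0)))"
        using that unfolding holds_in_def by simp
      then show ?thesis by (simp add: le_fmla_def bl_le_def)
    qed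
    obtain q where q: "q \<in> S" "q \<in> open_unit_rats" using assms(3,4) by blast
    then have "holds_in A (nontriviality_axiom q)" using ax by (simp add: QPi_axioms_def)
    then have "cst A q \<noteq> top_el A"
      using top unfolding holds_in_def nontriviality_axiom_def by auto
    then show "\<exists>q\<in>open_unit_rats. cst A q \<noteq> top_el A" using q by blast
  qed
  have no_root: "root n (of_rat (rat_of_unit p)) \<in> \<rat>"
    if "n \<ge> 1" "rat_of_unit p < 1" "z \<in> C" "pw z n = cst A p" for p n z
  proof (rule ccontr)
    assume "root n (of_rat (rat_of_unit p)) \<notin> \<rat>"
    then have "no_root_axiom p n \<in> QPi_axioms S" using that by (auto simp: QPi_axioms_def)
    from ax[OF this] have "holds_in A (Neg (Eq (Cst p) (pow_term (Var 0) n)))"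
      by (simp add: no_root_axiom_def holds_in_Forall)
    then have "sat A (\<lambda>_. z) (Neg (Eq (Cst p) (pow_term (Var 0) n)))"
      using that(3) unfolding holds_in_def by (auto dest: spec[of _ "\<lambda>_. z"])
    then show False using that(4) by (simp add: eval_pow_term)
  qed
  have "holds_in A \<psi>" if qf: "quantifier_free \<psi>" and holds: "holds_in Q_Pi \<psi>" for \<psi>
    unfolding holds_in_def
  proof (intro allI impI)
    fix v :: "nat \<Rightarrow> 'a"
    assume v: "\<forall>i. v i \<in> carrier A"
    show "sat A v \<psi>"
    proof (rule sat_in_Q_Pi[of v \<psi>])
      show "root n (of_rat (rat_of_unit p)) \<in> \<rat>"
        if "n \<ge> 1" "rat_of_unit p < 1" "z \<in> C" "pw z n = cst A p" for p n z
        using that by (rule no_root)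
      show "sat A v \<psi>" if "\<And>i. w i \<in> carrier Q_Pi" "sat Q_Pi w \<psi> \<longleftrightarrow> sat A v \<psi>" for w
        using that holds by (simp add: holds_in_def)
    qed (use v qf in auto)
  qed
  with str show ?thesis by (simp add: Mod_universal_theory_iff)
qed

section \<open>Models of the universal theory satisfy the axioms\<close>

primrec term_of_bl :: "bl_term \<Rightarrow> rpa_term" where
  "term_of_bl (BVar i) = Var i"
| "term_of_bl (BMeet s t) = Meet (term_of_bl s) (term_of_bl t)"
| "term_of_bl (BJoin s t) = Join (term_of_bl s) (term_of_bl t)"
| "term_of_bl (BMult s t) = Mult (term_of_bl s) (term_of_bl t)"
| "term_of_bl (BResid s t) = Resid (term_of_bl s) (term_of_bl t)"
| "term_of_bl BZero = Zero"
| "term_of_bl BOne = One"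

lemma eval_term_of_bl: "eval_term A v (term_of_bl t) = bl_eval A v t"
  by (induction t) auto

lemma bl_eval_Q_Pi: "bl_eval Q_Pi v t = bl_eval std_product_algebra v t"
  by (induction t) (auto simp: Q_Pi_def std_product_algebra_def)

lemma identity_holds_in_Q_Pi:
  assumes "bl_identity_holds std_product_algebra s t"
  shows "holds_in Q_Pi (Eq (term_of_bl s) (term_of_bl t))"
proof -
  have "carrier Q_Pi \<subseteq> carrier std_product_algebra"
    by (auto simp: Q_Pi_def std_product_algebra_def)
  then show ?thesis
    using assms by (auto simp: holds_in_def bl_identity_holds_def eval_term_of_bl bl_eval_Q_Pi)
qed

lemma eval_Q_Pi_pow: "eval_term Q_Pi v (pow_term t n) = eval_term Q_Pi v t ^ n"
  by (induction n) (auto simp: Q_Pi_def)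

locale Q_Pi_model =
  fixes A :: "'a rpa_struct"
  assumes A: "A \<in> Mod (universal_theory Q_Pi)"
begin

lemma transfer: "\<lbrakk>holds_in Q_Pi \<psi>; quantifier_free \<psi>\<rbrakk> \<Longrightarrow> holds_in A \<psi>"
  using A by (simp add: Mod_universal_theory_iff)

lemma rpa_structure: "rpa_structure A"
  using A by (simp add: Mod_def)

text \<open>Three variables suffice for the BL axioms. The check is made on the whole real unit
  interval, which contains the carrier of \<open>Q_Pi\<close>.\<close>

lemma transfer3:
  assumes "quantifier_free \<psi>"
    and "\<And>v. \<lbrakk>\<And>i. 0 \<le> v i; \<And>i. v i \<le> 1\<rbrakk> \<Longrightarrow> sat Q_Pi v \<psi>"
    and "x \<in> carrier A" "y \<in> carrier A" "z \<in> carrier A"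
  shows "sat A (\<lambda>i. if i = 0 then x else if i = 1 then y else z) \<psi>"
proof -
  have "holds_in Q_Pi \<psi>"
    using assms(2) by (auto simp: holds_in_def Q_Pi_def)
  from transfer[OF this assms(1)] show ?thesis
    using assms(3-) by (simp add: holds_in_def)
qed

text \<open>Apart from closure, which is part of \<open>Mod\<close>, membership in
  \<open>RPA\<close> is expressed by universal sentences: BL axioms, identities inherited by
  \<open>Q_Pi\<close> from the standard algebra as a subalgebra, and variable-free equations between
  constants.\<close>

lemma in_RPA: "A \<in> RPA"
proof -
  let ?x = "Var 0" and ?y = "Var 1" and ?z = "Var 2"
  have two: "meet A x y = meet A y x" "join A x y = join A y x"
    "meet A x (join A x y) = x" "join A x (meet A x y) = x"
    "bl_le A (bot_el A) x" "bl_le A x (top_el A)"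
    "mult A x y = mult A y x" "mult A x (top_el A) = x"
    if "x \<in> carrier A" "y \<in> carrier A" for x y
    using transfer3[of "Eq (Meet ?x ?y) (Meet ?y ?x)", OF _ _ that that(2)]
      transfer3[of "Eq (Join ?x ?y) (Join ?y ?x)", OF _ _ that that(2)]
      transfer3[of "Eq (Meet ?x (Join ?x ?y)) ?x", OF _ _ that that(2)]
      transfer3[of "Eq (Join ?x (Meet ?x ?y)) ?x", OF _ _ that that(2)]
      transfer3[of "Eq (Meet Zero ?x) Zero", OF _ _ that that(2)]
      transfer3[of "Eq (Meet ?x One) ?x", OF _ _ that that(2)]
      transfer3[of "Eq (Mult ?x ?y) (Mult ?y ?x)", OF _ _ that that(2)]
      transfer3[of "Eq (Mult ?x One) ?x", OF _ _ that that(2)]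
    by (simp_all add: Q_Pi_def bl_le_def min.commute max.commute mult.commute)
  have prelinear: "join A (resid A x y) (resid A y x) = top_el A"
    if "x \<in> carrier A" "y \<in> carrier A" for x y
  proof -
    have "max (prod_imp a c) (prod_imp c a) = 1" if "0 \<le> a" "0 \<le> c" for a c :: real
      using that by (auto simp: prod_imp_def max_def divide_le_eq)
    then show ?thesis
      using transfer3[of "Eq (Join (Resid ?x ?y) (Resid ?y ?x)) One", OF _ _ that that(2)]
      by (simp add: Q_Pi_def)
  qed
  have divisible: "meet A x y = mult A x (resid A x y)"
    if "x \<in> carrier A" "y \<in> carrier A" for x y
  proof -
    have "min a c = a * prod_imp a c" if "0 \<le> a" "0 \<le> c" for a c :: real
      using that by (auto simp: prod_imp_def min_def)
    then show ?thesis
      using transfer3[of "Eq (Meet ?x ?y) (Mult ?x (Resid ?x ?y))", OF _ _ that that(2)]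
      by (simp add: Q_Pi_def)
  qed
  have three: "meet A (meet A x y) z = meet A x (meet A y z)"
    "join A (join A x y) z = join A x (join A y z)"
    "mult A (mult A x y) z = mult A x (mult A y z)"
    if "x \<in> carrier A" "y \<in> carrier A" "z \<in> carrier A" for x y z
    using transfer3[of "Eq (Meet (Meet ?x ?y) ?z) (Meet ?x (Meet ?y ?z))", OF _ _ that]
      transfer3[of "Eq (Join (Join ?x ?y) ?z) (Join ?x (Join ?y ?z))", OF _ _ that]
      transfer3[of "Eq (Mult (Mult ?x ?y) ?z) (Mult ?x (Mult ?y ?z))", OF _ _ that]
    by (simp_all add: Q_Pi_def min.assoc max.assoc mult.assoc)
  have res: "bl_le A (mult A x y) z \<longleftrightarrow> bl_le A x (resid A y z)"
    if "x \<in> carrier A" "y \<in> carrier A" "z \<in> carrier A" for x y z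
  proof -
    let ?p = "le_fmla (Mult ?x ?y) ?z" and ?q = "le_fmla ?x (Resid ?y ?z)"
    have iff: "v 0 * v 1 \<le> v 2 \<longleftrightarrow> v 0 \<le> prod_imp (v 1) (v 2)"
      if v: "\<And>i. 0 \<le> v i" "\<And>i. v i \<le> 1" for v :: "nat \<Rightarrow> real"
    proof (cases "v 1 \<le> v 2")
      case True
      have "v 0 * v 1 \<le> 1 * v 1" using v by (intro mult_right_mono) auto
      then show ?thesis using True v by (auto simp: prod_imp_def)
    next
      case False
      then have "0 < v 1" using v(1)[of 2] by linarith
      then show ?thesis using False by (simp add: prod_imp_def pos_le_divide_eq)
    qed
    \<comment> \<open>Residuation is an equivalence of two equations, so it is transferred as a
      conjunction of two implications written with \<open>Neg\<close> and
      \<open>Disj\<close>.\<close>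
    have "sat A (\<lambda>i. if i = 0 then x else if i = 1 then y else z)
        (Conj (Disj (Neg ?p) ?q) (Disj (Neg ?q) ?p))"
    proof (rule transfer3[OF _ _ that])
      fix v :: "nat \<Rightarrow> real"
      assume "\<And>i. 0 \<le> v i" "\<And>i. v i \<le> 1"
      from iff[of v, OF this] show "sat Q_Pi v (Conj (Disj (Neg ?p) ?q) (Disj (Neg ?q) ?p))"
        by (auto simp: Q_Pi_def le_fmla_def simp flip: min.absorb_iff1)
    qed (simp add: le_fmla_def)
    then show ?thesis by (auto simp: le_fmla_def bl_le_def)
  qed
  have bl_str: "bl_structure A"
    using rpa_structure by (simp add: rpa_structure_def)
  have "bl_algebra A"
    unfolding bl_algebra_def bl_bounded_lattice_def bl_comm_monoid_def
    by (intro conjI ballI; rule bl_str two three res prelinear divisible; assumption)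
  moreover have "bl_identity_holds A s t" if "bl_identity_holds std_product_algebra s t" for s t
    using transfer[OF identity_holds_in_Q_Pi[OF that]]
    by (simp add: holds_in_def bl_identity_holds_def eval_term_of_bl)
  moreover have top: "top_el A \<in> carrier A"
    using rpa_structure by (simp add: rpa_structure_def bl_structure_def)
  have closed: "eval_term A (\<lambda>_. top_el A) s = eval_term A (\<lambda>_. top_el A) t"
    if "\<And>v. eval_term Q_Pi v s = eval_term Q_Pi v t" for s t
    using transfer[of "Eq s t"] that top by (auto simp: holds_in_def)
  have imp: "of_rat (prod_imp a b) = (prod_imp (of_rat a) (of_rat b) :: real)" for a b
    by (simp add: prod_imp_def of_rat_less_eq of_rat_divide)
  have "mult A (cst A p) (cst A q) = cst A (ur_mult p q)"
    "resid A (cst A p) (cst A q) = cst A (ur_imp p q)"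
    "cst A ur_zero = bot_el A" "cst A ur_one = top_el A" for p q
    using closed[of "Mult (Cst p) (Cst q)" "Cst (ur_mult p q)"]
      closed[of "Resid (Cst p) (Cst q)" "Cst (ur_imp p q)"]
      closed[of "Cst ur_zero" Zero] closed[of "Cst ur_one" One]
    by (simp_all add: Q_Pi_def ur_mult.rep_eq ur_imp.rep_eq ur_zero.rep_eq ur_one.rep_eq of_rat_mult imp)
  ultimately show ?thesis
    using rpa_structure by (simp add: RPA_def product_algebra_def)
qed

text \<open>All the axioms are prefixed quantifier-free formulas and so need checking only in
  \<open>Q_Pi\<close>. There a solution of a root equation is nonnegative and rational, hence equal
  to the real root, which is irrational.\<close>

lemma satisfies_axioms: "A \<in> Mod (QPi_axioms open_unit_rats)"
proof -
  have "holds_in A linearity_axiom"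
    unfolding linearity_axiom_def holds_in_Forall
    by (rule transfer) (auto simp: holds_in_def le_fmla_def Q_Pi_def min_def)
  moreover have "holds_in A (nontriviality_axiom q)" if "q \<in> open_unit_rats" for q
    by (rule transfer)
      (use that in \<open>auto simp: nontriviality_axiom_def holds_in_def Q_Pi_def open_unit_rats_def\<close>)
  moreover have "holds_in A (no_root_axiom p n)"
    if p: "n \<ge> 1" "root n (of_rat (rat_of_unit p)) \<notin> \<rat>" for p n
    unfolding no_root_axiom_def holds_in_Forall
  proof (rule transfer)
    show "holds_in Q_Pi (Neg (Eq (Cst p) (pow_term (Var 0) n)))"
      unfolding holds_in_def
    proof (intro allI impI)
      fix v :: "nat \<Rightarrow> real"
      assume "\<forall>i. v i \<in> carrier Q_Pi"
      then have v: "0 \<le> v 0" "v 0 \<in> \<rat>" by (auto simp: Q_Pi_def)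
      have "cst Q_Pi p \<noteq> v 0 ^ n"
      proof
        assume "cst Q_Pi p = v 0 ^ n"
        then have "root n (of_rat (rat_of_unit p)) = v 0"
          using v(1) p(1) by (simp add: Q_Pi_def real_root_power_cancel)
        with p(2) v(2) show False by simp
      qed
      then show "sat Q_Pi v (Neg (Eq (Cst p) (pow_term (Var 0) n)))"
        by (simp add: eval_Q_Pi_pow)
    qed
  qed simp
  ultimately show ?thesis
    using rpa_structure by (auto simp: Mod_def QPi_axioms_def)
qed

end

lemma Mod_QPi_axioms_mono: "S \<subseteq> S' \<Longrightarrow> Mod (QPi_axioms S') \<subseteq> Mod (QPi_axioms S)"
  by (auto simp: Mod_def QPi_axioms_def)

theorem theorem6p2:
  "(Mod (universal_theory Q_Pi) :: 'a rpa_struct set)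
       = RPA \<inter> Mod (QPi_axioms open_unit_rats) \<and>
   (\<forall>q\<in>open_unit_rats.
      (Mod (universal_theory Q_Pi) :: 'a rpa_struct set)
        = RPA \<inter> Mod (QPi_axioms {q}))"
proof -
  \<comment> \<open>Both conjuncts are instances for a nonempty set \<open>S\<close>: all of
    \<open>open_unit_rats\<close>, for which 1 / 2 is the witness, and a singleton.\<close>
  have axiomatized: "(Mod (universal_theory Q_Pi) :: 'a rpa_struct set) = RPA \<inter> Mod (QPi_axioms S)"
    if S: "S \<noteq> {}" "S \<subseteq> open_unit_rats" for S
  proof (intro equalityI subsetI)
    fix A :: "'a rpa_struct"
    assume "A \<in> Mod (universal_theory Q_Pi)"
    then interpret Q_Pi_model A by unfold_locales
    show "A \<in> RPA \<inter> Mod (QPi_axioms S)"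
      using in_RPA satisfies_axioms Mod_QPi_axioms_mono[OF S(2)] by blast
  qed (use S model_in_Mod_universal_theory in blast)
  have "Abs_unit_rat (1 / 2) \<in> open_unit_rats"
    by (simp add: open_unit_rats_def Abs_unit_rat_inverse)
  then show ?thesis using axiomatized by blast
qed

end
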